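(* Let $p\in\{59,83,107,179,227,347,419,443,467,563,587,659,683,827,947\}$. Then there is no $m\in\mathbb{N}$ and no pair of coprime positive integers $(x,y)$ with $$x^2+3^{2m}=2y^p.$$
   Context: $\mathbb{N}$ denotes the positive integers. *)

theory Defs
  imports Main
begin

end

theory Submission
  imports Defs Complex_Main "HOL-Number_Theory.Number_Theory"
    "HOL-Computational_Algebra.Computational_Algebra"
begin

text \<open>
  Unique factorisation in \<open>\<int>[\<i>]\<close> turns a solution into integers \<open>s\<close> and \<open>d = 3\<^sup>m\<close> with
  \<open>Im ((s + \<i> d)\<^sup>p) = 2\<^bsup>(p-1)/2\<^esup> d\<close>: both the divisor \<open>d\<close> of the imaginary part and the sign are forced
  modulo 3. The pair \<open>s = d = 1\<close> solves this equation, so congruences alone cannot exclude it; they do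
  give \<open>m \<ge> 12\<close>.

  The imaginary part divided by \<open>d\<close> is \<open>\<Phi>\<^sub>p(\<alpha>, \<alpha>')\<close> with \<open>\<alpha> = s + \<i> d\<close> and its conjugate \<open>\<alpha>'\<close>. Splitting the
  cyclotomic form over quadratic residues and non-residues (Gauss) gives \<open>p Y\<^sup>2 - X\<^sup>2 = 4 \<Phi>\<^sub>p(\<alpha>, \<alpha>')\<close> with
  \<open>3\<^sup>m\<close> dividing \<open>X\<close>. Removing powers of 2 leaves \<open>p b\<^sup>2 - a\<^sup>2 = 2\<close>, hence the solution
  \<open>T = a\<^sup>2 + 1\<close>, \<open>W = a b\<close> of the Pell equation \<open>T\<^sup>2 - p W\<^sup>2 = 1\<close> with \<open>3\<^sup>m\<close> dividing \<open>W\<close>. By lifting the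
  exponent it is a power of the least solution with 3 dividing \<open>W\<close> whose exponent is at least a constant
  times \<open>3\<^sup>m\<close>, so \<open>log T\<close> grows like \<open>3\<^sup>m\<close>. On the other hand \<open>\<bar>s\<bar> < 2 p d\<close> bounds \<open>log T\<close> by a linear
  function of \<open>m\<close>.
\<close>

section \<open>Powers of 3 in solutions of Pell equations\<close>

text \<open>Coefficients of \<open>(t + w sqrt D) ^ n\<close> as a pair (rational part, coefficient
  of \<open>sqrt D\<close>). Integer pairs keep divisibility by 3 directly accessible.\<close>

fun pell_pow :: "int \<Rightarrow> int \<times> int \<Rightarrow> nat \<Rightarrow> int \<times> int" where
  "pell_pow D (t, w) 0 = (1, 0)"
| "pell_pow D (t, w) (Suc n) =
     (case pell_pow D (t, w) n of (a, b) \<Rightarrow> (t * a + D * w * b, t * b + w * a))"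

lemma pell_pow_0 [simp]: "pell_pow D e 0 = (1, 0)"
  by (cases e) simp

lemma pell_pow_add:
  assumes "pell_pow D e m = (a, b)" "pell_pow D e n = (a', b')"
  shows "pell_pow D e (m + n) = (a * a' + D * b * b', a * b' + b * a')"
  using assms
proof (induction m arbitrary: a b)
  case 0
  then show ?case by simp
next
  case (Suc m)
  obtain t w where e: "e = (t, w)" by (cases e)
  obtain c d where cd: "pell_pow D e m = (c, d)" by (cases "pell_pow D e m")
  show ?case
    using Suc.IH[OF cd Suc.prems(2)] Suc.prems(1) cd by (auto simp: e algebra_simps)
qed

lemma pell_pow_mult: "pell_pow D (pell_pow D e k) n = pell_pow D e (n * k)"
proof (induction n)
  case 0
  then show ?case by simp
next
  case (Suc n)
  obtain a b where ab: "pell_pow D e k = (a, b)" by fastforce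
  obtain c d where cd: "pell_pow D e (n * k) = (c, d)" by fastforce
  have "pell_pow D (a, b) n = (c, d)" using Suc ab cd by simp
  then show ?case using pell_pow_add[OF ab cd] by (simp add: ab mult.commute)
qed

lemma pell_pow_norm:
  assumes "t\<^sup>2 - D * w\<^sup>2 = (1::int)" "pell_pow D (t, w) n = (a, b)"
  shows "a\<^sup>2 - D * b\<^sup>2 = 1"
  using assms(2)
proof (induction n arbitrary: a b)
  case 0
  then show ?case by simp
next
  case (Suc n)
  obtain c d where cd: "pell_pow D (t, w) n = (c, d)" by fastforce
  have ab: "a = t * c + D * w * d" "b = t * d + w * c"
    using Suc.prems cd by auto
  have "a\<^sup>2 - D * b\<^sup>2 = (t\<^sup>2 - D * w\<^sup>2) * (c\<^sup>2 - D * d\<^sup>2)"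
    unfolding ab by (simp add: power2_eq_square algebra_simps)
  then show ?case using assms(1) Suc.IH[OF cd] by simp
qed

lemma pell_pow_ge:
  assumes "t \<ge> 1" "w \<ge> 0" "D \<ge> 0" "pell_pow D (t, w) n = (a, b)"
  shows "a \<ge> t ^ n \<and> b \<ge> 0"
  using assms(4)
proof (induction n arbitrary: a b)
  case 0
  then show ?case by simp
next
  case (Suc n)
  obtain c d where cd: "pell_pow D (t, w) n = (c, d)" by fastforce
  have ab: "a = t * c + D * w * d" "b = t * d + w * c"
    using Suc.prems cd by auto
  have c: "c \<ge> t ^ n" "d \<ge> 0" using Suc.IH[OF cd] by auto
  have "t * c \<ge> t * t ^ n" using c assms(1) by (intro mult_left_mono) auto
  moreover have "c \<ge> 0" using c(1) assms(1) order.trans[of 0 "t^n" c] by simp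
  moreover have "D * w * d \<ge> 0" "t * d \<ge> 0" using assms c by auto
  ultimately show ?case unfolding ab power_Suc using assms c by (simp add: add_increasing2)
qed

lemma pell_pow_dvd_snd: "pell_pow D (t, w) n = (a, b) \<Longrightarrow> w dvd b"
proof (induction n arbitrary: a b)
  case 0
  then show ?case by simp
next
  case (Suc n)
  obtain c d where cd: "pell_pow D (t, w) n = (c, d)" by fastforce
  have "b = t * d + w * c" using Suc.prems cd by auto
  then show ?case using Suc.IH[OF cd] by simp
qed

text \<open>Binomial expansion of \<open>(t + w sqrt D) ^ n\<close>: in the second coordinate every
  term after \<open>n t ^ (n - 1) w\<close> carries \<open>w ^ 3\<close>. The extra factor
  \<open>t\<close> in front of \<open>b\<close> avoids the exponent \<open>n - 1\<close>.\<close>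

lemma pell_pow_mod_cube:
  "pell_pow D (t, w) n = (a, b) \<Longrightarrow>
    w\<^sup>2 dvd a - t ^ n \<and> w ^ 3 dvd t * b - int n * t ^ n * w"
proof (induction n arbitrary: a b)
  case 0
  then show ?case by simp
next
  case (Suc n)
  obtain c d where cd: "pell_pow D (t, w) n = (c, d)" by fastforce
  have ab: "a = t * c + D * w * d" "b = t * d + w * c"
    using Suc.prems cd by auto
  obtain k where k: "c - t ^ n = w\<^sup>2 * k" using Suc.IH[OF cd] by auto
  obtain l where l: "t * d - int n * t ^ n * w = w ^ 3 * l" using Suc.IH[OF cd] by auto
  obtain r where r: "d = w * r" using pell_pow_dvd_snd[OF cd] by auto
  have "a - t ^ Suc n = w\<^sup>2 * (t * k + D * r)"
  proof -
    have "a - t ^ Suc n = t * (c - t ^ n) + D * w * d" unfolding ab by (simp add: algebra_simps)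
    then show ?thesis unfolding k r by (simp add: power2_eq_square algebra_simps)
  qed
  moreover have "t * b - int (Suc n) * t ^ Suc n * w = w ^ 3 * (t * l + t * k)"
  proof -
    have "t * b - int (Suc n) * t ^ Suc n * w =
        t * (t * d - int n * t ^ n * w) + t * w * (c - t ^ n)"
      unfolding ab by (simp add: algebra_simps)
    then show ?thesis unfolding k l by (simp add: power2_eq_square power3_eq_cube algebra_simps)
  qed
  ultimately show ?case by simp
qed

text \<open>Lifting the exponent. Norm 1 and \<open>3 dvd w\<close> make \<open>t\<close> prime to
  3, so \<open>t * b\<close> being congruent to \<open>n t ^ n w\<close> modulo
  \<open>3 ^ (c + 1)\<close> forces \<open>3 dvd n\<close>. Passing to the cube of the base adds
  exactly one factor 3 to \<open>w\<close>, and the induction on \<open>j\<close> continues with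
  \<open>n div 3\<close>.\<close>

lemma pell_pow_lte:
  assumes "t\<^sup>2 - D * w\<^sup>2 = (1::int)" "c \<ge> 1" "3 ^ c dvd w" "\<not> 3 ^ Suc c dvd w"
    and "pell_pow D (t, w) n = (a, b)" "3 ^ (c + j) dvd b"
  shows "3 ^ j dvd n"
  using assms
proof (induction j arbitrary: t w c n a b)
  case 0
  then show ?case by simp
next
  case (Suc j)
  have "(3::int) dvd 3 ^ c" using Suc.prems(2) by (simp add: dvd_power)
  then have w3: "3 dvd w" using Suc.prems(3) dvd_trans by blast
  have t3: "\<not> 3 dvd t"
  proof
    assume "3 dvd t"
    then have "3 dvd t\<^sup>2 - D * w\<^sup>2" using w3 by (simp add: power2_eq_square)
    then show False using Suc.prems(1) by simp
  qed
  have p3: "prime (3::int)" by (rule prime_int_numeral_eq[THEN iffD2]) simp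
  obtain u where u: "w = 3 ^ c * u" using Suc.prems(3) by auto
  have u3: "\<not> 3 dvd u" using Suc.prems(4) u by auto
  have "3 ^ Suc c dvd w ^ 3"
  proof -
    have "(3::int) ^ Suc c dvd 3 ^ (c * 3)" using Suc.prems(2) by (intro le_imp_power_dvd) simp
    then show ?thesis unfolding u power_mult_distrib power_mult [symmetric] by simp
  qed
  moreover have "w ^ 3 dvd t * b - int n * t ^ n * w"
    using pell_pow_mod_cube[OF Suc.prems(5)] by simp
  ultimately have 1: "3 ^ Suc c dvd t * b - int n * t ^ n * w" by (rule dvd_trans)
  have "(3::int) ^ Suc c dvd 3 ^ (c + Suc j)" by (intro le_imp_power_dvd) simp
  then have "3 ^ Suc c dvd b" using Suc.prems(6) by (rule dvd_trans)
  then have "3 ^ Suc c dvd t * b" by (rule dvd_mult)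
  from dvd_diff[OF this 1] have "3 ^ Suc c dvd int n * t ^ n * w" by simp
  then have "3 ^ c * 3 dvd 3 ^ c * (int n * t ^ n * u)" unfolding u by (simp add: mult_ac)
  then have "3 dvd int n * t ^ n * u" by simp
  then have "3 dvd int n"
    using u3 t3 p3 by (metis prime_dvd_mult_iff prime_dvd_power)
  then have "3 dvd n" by presburger
  then obtain n' where n': "n = n' * 3" by (auto simp: dvd_def mult.commute)
  obtain t' w' where e': "pell_pow D (t, w) 3 = (t', w')" by fastforce
  have w': "w' = w * (3 * t\<^sup>2 + D * w\<^sup>2)"
    using e' by (simp add: numeral_3_eq_3 power2_eq_square algebra_simps)
  have norm': "t'\<^sup>2 - D * w'\<^sup>2 = 1" by (rule pell_pow_norm[OF Suc.prems(1) e'])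
  \<comment> \<open>With \<open>w = 3 v\<close> the cofactor \<open>3 t^2 + D w^2\<close> is
    \<open>3 (t^2 + 3 D v^2)\<close>, and the bracket is prime to 3.\<close>
  obtain v where v: "w = 3 * v" using w3 by auto
  have w'': "w' = 3 ^ Suc c * (u * (t\<^sup>2 + 3 * (D * v\<^sup>2)))"
    unfolding w' using u v by (simp add: power2_eq_square algebra_simps)
  have "\<not> 3 dvd t\<^sup>2" using t3 p3 prime_dvd_power by blast
  then have "\<not> 3 dvd t\<^sup>2 + 3 * (D * v\<^sup>2)" by presburger
  then have "\<not> 3 dvd u * (t\<^sup>2 + 3 * (D * v\<^sup>2))" using u3 p3 by (simp add: prime_dvd_mult_iff)
  then have nd: "\<not> 3 ^ Suc (Suc c) dvd w'" unfolding w'' power_Suc2 [of _ "Suc c"] by (subst dvd_mult_cancel_left) simp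
  have "pell_pow D (t', w') n' = (a, b)"
    using pell_pow_mult[of D "(t, w)" 3 n'] e' n' Suc.prems(5) by simp
  then have "3 ^ j dvd n'"
    using Suc.IH[of t' w' "Suc c" n' a b] norm' nd w'' Suc.prems(6) by simp
  then show ?case unfolding n' by (simp add: mult.commute)
qed

text \<open>Descent: dividing a solution by the least one gives a smaller solution whose second
  coordinate is still divisible by \<open>k\<close>, until the least solution itself is
  reached.\<close>

lemma pell_generated:
  fixes D :: int
  assumes D: "D > 0" and e: "t\<^sup>2 - D * w\<^sup>2 = 1" "t > 0" "w > 0" "k dvd w"
    and min: "\<And>t' w'. t'\<^sup>2 - D * w'\<^sup>2 = 1 \<Longrightarrow> t' > 0 \<Longrightarrow> w' > 0 \<Longrightarrow> k dvd w' \<Longrightarrow> w \<le> w'"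
    and s: "T\<^sup>2 - D * W\<^sup>2 = 1" "T > 0" "W > 0" "k dvd W"
  shows "\<exists>n. pell_pow D (t, w) n = (T, W)"
  using s
proof (induction "nat W" arbitrary: T W rule: less_induct)
  case less
  have wW: "w \<le> W" using min less.prems by blast
  show ?case
  proof (cases "w = W")
    case True
    have "T\<^sup>2 = t\<^sup>2" using less.prems(1) e(1) True by simp
    then have "T = t" using less.prems(2) e(2) by (simp add: power2_eq_iff_nonneg)
    then have "pell_pow D (t, w) (Suc 0) = (T, W)" using True by simp
    then show ?thesis by blast
  next
    case False
    then have wW: "w < W" using wW by simp
    \<comment> \<open>The pair is the product of \<open>T + W sqrt D\<close> with the inverse
      \<open>t - w sqrt D\<close>. What remains is that both coordinates are positive and that
      \<open>W' < W\<close>, each shown by comparing squares.\<close>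
    define T' where "T' = T * t - D * W * w"
    define W' where "W' = W * t - T * w"
    have n: "T'\<^sup>2 - D * W'\<^sup>2 = 1"
    proof -
      have "T'\<^sup>2 - D * W'\<^sup>2 = (T\<^sup>2 - D * W\<^sup>2) * (t\<^sup>2 - D * w\<^sup>2)"
        unfolding T'_def W'_def by (simp add: power2_eq_square algebra_simps)
      then show ?thesis using less.prems(1) e(1) by simp
    qed
    have "w\<^sup>2 < W\<^sup>2" using wW e(3) by (simp add: power_strict_mono)
    moreover have "(W * t)\<^sup>2 - (T * w)\<^sup>2 = W\<^sup>2 - w\<^sup>2"
    proof -
      have "t\<^sup>2 = 1 + D * w\<^sup>2" "T\<^sup>2 = 1 + D * W\<^sup>2" using less.prems(1) e(1) by simp_all
      then show ?thesis by (simp add: power_mult_distrib algebra_simps)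
    qed
    ultimately have "(T * w)\<^sup>2 < (W * t)\<^sup>2" by simp
    then have W'0: "W' > 0" unfolding W'_def
      using less.prems e by (simp add: power2_less_imp_less)
    have "(T * t)\<^sup>2 = (D * W * w)\<^sup>2 + D * W\<^sup>2 + D * w\<^sup>2 + 1"
    proof -
      have "t\<^sup>2 = 1 + D * w\<^sup>2" "T\<^sup>2 = 1 + D * W\<^sup>2" using less.prems(1) e(1) by simp_all
      then show ?thesis by (simp add: power_mult_distrib power2_eq_square[of D] algebra_simps)
    qed
    then have "(D * W * w)\<^sup>2 < (T * t)\<^sup>2" using D by (simp add: add_pos_nonneg add_nonneg_pos)
    then have T'0: "T' > 0" unfolding T'_def
      using less.prems e by (simp add: power2_less_imp_less)
    have "t\<^sup>2 > 1" using e D by (metis add_0 add.commute diff_eq_eq zero_less_mult_iff zero_less_power less_add_same_cancel1 power_one)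
    then have t1: "t > 1" using e(2) by (metis not_less one_power2 power_mono order.strict_implies_order power2_less_imp_less)
    \<comment> \<open>This is \<open>W' < W\<close> in squared form, since \<open>W' < W\<close>
      means \<open>(t - 1) * W < T * w\<close>.\<close>
    have "(t - 1)\<^sup>2 * W\<^sup>2 < (T * w)\<^sup>2"
    proof -
      have "t\<^sup>2 = 1 + D * w\<^sup>2" "T\<^sup>2 = 1 + D * W\<^sup>2" using less.prems(1) e(1) by simp_all
      then have "(T * w)\<^sup>2 - (t - 1)\<^sup>2 * W\<^sup>2 = w\<^sup>2 + 2 * (t - 1) * W\<^sup>2"
        by (simp add: power_mult_distrib power2_diff algebra_simps)
      moreover have "\<dots> > 0" using e(3) t1 by (intro add_pos_nonneg) auto
      ultimately show ?thesis by simp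
    qed
    then have "((t - 1) * W)\<^sup>2 < (T * w)\<^sup>2" by (simp add: power_mult_distrib)
    then have "(t - 1) * W < T * w"
      by (rule power2_less_imp_less) (use less.prems e in simp)
    then have "W' < W" unfolding W'_def by (simp add: algebra_simps)
    then have "nat W' < nat W" using W'0 by simp
    moreover have "k dvd W'" unfolding W'_def using less.prems(4) e(4) by simp
    ultimately obtain n where "pell_pow D (t, w) n = (T', W')"
      using less.hyps[of W' T'] n T'0 W'0 by blast
    then have "pell_pow D (t, w) (Suc n) = (t * T' + D * w * W', t * W' + w * T')" by simp
    moreover have "t * T' + D * w * W' = T * (t\<^sup>2 - D * w\<^sup>2)"
      unfolding T'_def W'_def by (simp add: power2_eq_square algebra_simps)
    then have "t * T' + D * w * W' = T" using e(1) by simp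
    moreover have "t * W' + w * T' = W * (t\<^sup>2 - D * w\<^sup>2)"
      unfolding T'_def W'_def by (simp add: power2_eq_square algebra_simps)
    then have "t * W' + w * T' = W" using e(1) by simp
    ultimately show ?thesis by metis
  qed
qed

text \<open>A single solution bounds the power of 3 in the minimal solution divisible by 3.\<close>

lemma pell_large:
  fixes D :: int
  assumes D: "D > 0" and cert: "t0\<^sup>2 - D * w0\<^sup>2 = 1" "t0 > 0" "w0 > 0" "3 dvd w0" "\<not> 3 ^ Suc c0 dvd w0"
    and s: "T\<^sup>2 - D * W\<^sup>2 = 1" "T > 0" "W > 0" "3 ^ m dvd W" "m \<ge> c0" "m \<ge> 1"
  shows "T\<^sup>2 \<ge> (9 ^ c0 * D) ^ (3 ^ (m - c0))"
proof -
  define Q where "Q = (\<lambda>n. \<exists>t. t\<^sup>2 - D * (int n)\<^sup>2 = 1 \<and> t > 0 \<and> n > 0 \<and> 3 dvd int n)"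
  have "Q (nat w0)" unfolding Q_def using cert by auto
  define N where "N = (LEAST n. Q n)"
  have "Q N" unfolding N_def using \<open>Q (nat w0)\<close> by (rule LeastI)
  then obtain t where t: "t\<^sup>2 - D * (int N)\<^sup>2 = 1" "t > 0" "N > 0" "3 dvd int N"
    unfolding Q_def by blast
  have min: "int N \<le> w'" if "t'\<^sup>2 - D * w'\<^sup>2 = 1" "t' > 0" "w' > 0" "3 dvd w'" for t' w'
  proof -
    have "Q (nat w')" unfolding Q_def using that by auto
    then have "N \<le> nat w'" unfolding N_def by (rule Least_le)
    then show ?thesis using that by simp
  qed
  have gen: "\<exists>n. pell_pow D (t, int N) n = (T', W')"
    if "T'\<^sup>2 - D * W'\<^sup>2 = 1" "T' > 0" "W' > 0" "3 dvd W'" for T' W'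
    by (rule pell_generated[where k = 3]) (use D t min that in auto)
  define c where "c = multiplicity 3 (int N)"
  have dvd_iff: "3 ^ k dvd int N \<longleftrightarrow> k \<le> c" for k
    unfolding c_def using t(3) by (intro power_dvd_iff_le_multiplicity) auto
  have c1: "c \<ge> 1" using dvd_iff[of 1] t(4) by simp
  \<comment> \<open>The known solution is a power of the least one, so its 3-adic valuation bounds
    that of \<open>N\<close>; the least solution itself never has to be identified.\<close>
  have "int N dvd w0" using gen[of t0 w0] cert pell_pow_dvd_snd by blast
  then have "\<not> 3 ^ Suc c0 dvd int N" using cert(5) dvd_trans by blast
  then have cc0: "c \<le> c0" using dvd_iff[of "Suc c0"] by simp
  have "(3::int) dvd 3 ^ m" using s(6) by (simp add: dvd_power)
  then have W3: "3 dvd W" using s(4) dvd_trans by blast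
  obtain n where n: "pell_pow D (t, int N) n = (T, W)" using gen[of T W] s W3 by blast
  have "3 ^ (m - c) dvd n"
  proof (rule pell_pow_lte[OF t(1) c1 _ _ n])
    show "3 ^ c dvd int N" "\<not> 3 ^ Suc c dvd int N" using dvd_iff[of c] dvd_iff[of "Suc c"] by simp_all
    show "3 ^ (c + (m - c)) dvd W" using s(4,5) cc0 by simp
  qed
  moreover have "n > 0" using n s(3) by (intro Nat.gr0I) auto
  ultimately have le: "3 ^ (m - c) \<le> n" by (rule dvd_imp_le)
  have "T \<ge> t ^ n" using pell_pow_ge[OF _ _ _ n] t D by simp
  then have "T\<^sup>2 \<ge> (t ^ n)\<^sup>2" using t(2) by (intro power_mono) auto
  moreover have "(t ^ n)\<^sup>2 = (t\<^sup>2) ^ n" by (simp add: power_mult [symmetric] mult.commute)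
  moreover have "9 ^ c * D \<le> t\<^sup>2"
  proof -
    have "3 ^ c \<le> int N" using t(3) dvd_iff[of c] by (intro zdvd_imp_le) auto
    then have "(3 ^ c)\<^sup>2 \<le> (int N)\<^sup>2" by (intro power_mono) auto
    also have "(3 ^ c)\<^sup>2 = (9 ^ c :: int)" by (simp add: power2_eq_square flip: power_mult_distrib)
    finally have "D * 9 ^ c \<le> D * (int N)\<^sup>2" using D by (intro mult_left_mono) auto
    then show ?thesis using t(1) by (simp add: mult.commute)
  qed
  then have "(9 ^ c * D) ^ n \<le> (t\<^sup>2) ^ n" using D by (intro power_mono) auto
  moreover have "(9::int) ^ 1 * 1 \<le> 9 ^ c * D"
    using c1 D by (intro mult_mono power_increasing) auto
  then have X: "9 \<le> 9 ^ c * D" by simp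
  have "(9 ^ c * D) ^ (3 ^ (m - c)) \<le> (9 ^ c * D) ^ n"
    by (rule power_increasing[OF le]) (use X in linarith)
  moreover have "(9 ^ c0 * D) ^ (3 ^ (m - c0)) \<le> (9 ^ c * D) ^ (3 ^ (m - c))"
  proof -
    \<comment> \<open>Raising \<open>c\<close> to \<open>c0\<close> only weakens the bound: the base
      grows by \<open>9 ^ k\<close>, at most its own \<open>k\<close>-th power, while the exponent
      shrinks by the factor \<open>3 ^ k\<close>, which is at least \<open>k + 1\<close>.\<close>
    define k where "k = c0 - c"
    have "j < 3 ^ j" for j :: nat by (induction j) auto
    then have "k < 3 ^ k" .
    have "9 ^ c0 * D = 9 ^ k * (9 ^ c * D)" using cc0 by (simp add: k_def flip: power_add)
    also have "\<dots> \<le> (9 ^ c * D) ^ k * (9 ^ c * D)" 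
      by (intro mult_right_mono power_mono) (use X in linarith)+
    also have "\<dots> = (9 ^ c * D) ^ Suc k" by (simp only: power_Suc2)
    also have "\<dots> \<le> (9 ^ c * D) ^ (3 ^ k)"
      by (rule power_increasing) (use X \<open>k < 3 ^ k\<close> in linarith)+
    finally have "(9 ^ c0 * D) ^ (3 ^ (m - c0)) \<le> ((9 ^ c * D) ^ (3 ^ k)) ^ (3 ^ (m - c0))"
      using D by (intro power_mono) auto
    also have "\<dots> = (9 ^ c * D) ^ (3 ^ k * 3 ^ (m - c0))" by (simp only: power_mult)
    also have "3 ^ k * 3 ^ (m - c0) = (3 ^ (m - c) :: nat)"
      using cc0 s(5) by (simp add: k_def flip: power_add)
    finally show ?thesis .
  qed
  ultimately show ?thesis by linarith
qed

section \<open>Gaussian integers\<close>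

text \<open>The ring of Gaussian integers as a subset of the complex numbers, so that norm,
  conjugation and division are those of the complex field.\<close>

definition gauss_ints :: "complex set" where
  "gauss_ints = {z. Re z \<in> \<int> \<and> Im z \<in> \<int>}"

lemma gauss_ints_add [intro]: "a \<in> gauss_ints \<Longrightarrow> b \<in> gauss_ints \<Longrightarrow> a + b \<in> gauss_ints"
  and gauss_ints_diff [intro]: "a \<in> gauss_ints \<Longrightarrow> b \<in> gauss_ints \<Longrightarrow> a - b \<in> gauss_ints"
  and gauss_ints_mult [intro]: "a \<in> gauss_ints \<Longrightarrow> b \<in> gauss_ints \<Longrightarrow> a * b \<in> gauss_ints"
  and gauss_ints_minus [intro]: "a \<in> gauss_ints \<Longrightarrow> - a \<in> gauss_ints"
  and gauss_ints_cnj [intro]: "a \<in> gauss_ints \<Longrightarrow> cnj a \<in> gauss_ints"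
  and gauss_ints_of_int [simp, intro]: "of_int n \<in> gauss_ints"
  and gauss_ints_0 [simp, intro]: "0 \<in> gauss_ints"
  and gauss_ints_1 [simp, intro]: "1 \<in> gauss_ints"
  and gauss_ints_numeral [simp, intro]: "numeral k \<in> gauss_ints"
  and gauss_ints_i [simp, intro]: "\<i> \<in> gauss_ints"
  by (simp_all add: gauss_ints_def)

lemma gauss_ints_power [intro]: "a \<in> gauss_ints \<Longrightarrow> a ^ n \<in> gauss_ints"
  by (induction n) auto

lemma gauss_ints_sum [intro]: "(\<And>i. i \<in> A \<Longrightarrow> f i \<in> gauss_ints) \<Longrightarrow> sum f A \<in> gauss_ints"
  by (induction A rule: infinite_finite_induct) auto

lemma gauss_ints_Complex [simp, intro]: "Complex (of_int a) (of_int b) \<in> gauss_ints"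
  by (simp add: gauss_ints_def)

lemma gauss_intsE:
  assumes "z \<in> gauss_ints"
  obtains a b where "z = Complex (of_int a) (of_int b)"
  using assms by (metis (mono_tags, lifting) Ints_cases complex.collapse gauss_ints_def mem_Collect_eq)

text \<open>Rounding both coordinates of \<open>a / b\<close> leaves an error of squared norm at
  most 1/2.\<close>

lemma gauss_ints_division:
  assumes "a \<in> gauss_ints" "b \<in> gauss_ints" "b \<noteq> 0"
  obtains q where "q \<in> gauss_ints" "norm (a - q * b) < norm b"
proof
  define z where "z = a / b"
  define q where "q = Complex (of_int (round (Re z))) (of_int (round (Im z)))"
  show "q \<in> gauss_ints" by (simp add: q_def)
  have "\<bar>Re (z - q)\<bar> \<le> 1 / 2" "\<bar>Im (z - q)\<bar> \<le> 1 / 2"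
    using of_int_round_abs_le[of "Re z"] of_int_round_abs_le[of "Im z"]
    by (simp_all add: q_def abs_minus_commute)
  then have "(Re (z - q))\<^sup>2 \<le> (1 / 2)\<^sup>2" "(Im (z - q))\<^sup>2 \<le> (1 / 2)\<^sup>2"
    by (metis abs_ge_zero power2_abs power_mono)+
  then have "(norm (z - q))\<^sup>2 < 1\<^sup>2" unfolding cmod_power2 by (simp add: power_divide)
  then have "norm (z - q) < 1" by (rule power2_less_imp_less) simp
  moreover have "a - q * b = (z - q) * b" using assms by (simp add: z_def algebra_simps)
  ultimately show "norm (a - q * b) < norm b" using assms by (simp add: norm_mult)
qed

text \<open>Euclidean algorithm. The element \<open>\<mu> * a + \<nu> * b\<close> serves as greatest
  common divisor. Squared norms of Gaussian integers are integers, so the floor in the induction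
  measure loses nothing.\<close>

lemma gauss_ints_bezout:
  assumes "a \<in> gauss_ints" "b \<in> gauss_ints"
  shows "\<exists>\<mu>\<in>gauss_ints. \<exists>\<nu>\<in>gauss_ints. \<exists>a'\<in>gauss_ints. \<exists>b'\<in>gauss_ints.
    a = (\<mu> * a + \<nu> * b) * a' \<and> b = (\<mu> * a + \<nu> * b) * b'"
  using assms
proof (induction "nat \<lfloor>(norm b)\<^sup>2\<rfloor>" arbitrary: a b rule: less_induct)
  case less
  show ?case
  proof (cases "b = 0")
    case True
    then show ?thesis by (intro bexI[of _ 1] bexI[of _ 0]) auto
  next
    case False
    obtain q where q: "q \<in> gauss_ints" "norm (a - q * b) < norm b"
      using gauss_ints_division less.prems False by blast
    define r where "r = a - q * b"
    have r: "r \<in> gauss_ints" using q less.prems by (auto simp: r_def)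
    have int: "(norm z)\<^sup>2 = of_int \<lfloor>(norm z)\<^sup>2\<rfloor>" if "z \<in> gauss_ints" for z
    proof -
      obtain c d where z: "z = Complex (of_int c) (of_int d)" using gauss_intsE \<open>z \<in> _\<close> by blast
      have "(norm z)\<^sup>2 = of_int (c\<^sup>2 + d\<^sup>2)" by (simp add: z cmod_power2)
      then show ?thesis by simp
    qed
    have "(norm r)\<^sup>2 < (norm b)\<^sup>2" using q by (simp add: r_def power_strict_mono)
    then have "\<lfloor>(norm r)\<^sup>2\<rfloor> < \<lfloor>(norm b)\<^sup>2\<rfloor>" using int[OF r] int[OF less.prems(2)] by linarith
    moreover have "\<lfloor>(norm r)\<^sup>2\<rfloor> \<ge> 0" by simp
    ultimately have "nat \<lfloor>(norm r)\<^sup>2\<rfloor> < nat \<lfloor>(norm b)\<^sup>2\<rfloor>" by linarith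
    from less.hyps[OF this less.prems(2) r] obtain \<mu> \<nu> b' r' where
      m: "\<mu> \<in> gauss_ints" "\<nu> \<in> gauss_ints" "b' \<in> gauss_ints" "r' \<in> gauss_ints"
      "b = (\<mu> * b + \<nu> * r) * b'" "r = (\<mu> * b + \<nu> * r) * r'" by blast
    define g where "g = \<mu> * b + \<nu> * r"
    have g: "g = \<nu> * a + (\<mu> - \<nu> * q) * b" by (simp add: g_def r_def algebra_simps)
    have "a = r + q * b" by (simp add: r_def)
    also have "\<dots> = g * r' + q * (g * b')" using m(5,6) unfolding g_def by simp
    finally have "a = g * (r' + q * b')" by (simp add: algebra_simps)
    moreover have "b = g * b'" using m(5) unfolding g_def .
    moreover have "\<mu> - \<nu> * q \<in> gauss_ints" "r' + q * b' \<in> gauss_ints" using m q by auto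
    ultimately show ?thesis using m g by metis
  qed
qed

lemma gauss_ints_power_add:
  assumes "a \<in> gauss_ints" "b \<in> gauss_ints"
  shows "\<exists>k\<in>gauss_ints. (a + b) ^ n = a * k + b ^ n"
proof (induction n)
  case 0
  then show ?case by (intro bexI[of _ 0]) auto
next
  case (Suc n)
  then obtain k where k: "k \<in> gauss_ints" "(a + b) ^ n = a * k + b ^ n" by blast
  have "(a + b) ^ Suc n = a * ((a + b) * k + b ^ n) + b ^ Suc n"
    using k by (simp add: algebra_simps)
  moreover have "(a + b) * k + b ^ n \<in> gauss_ints" using k assms by auto
  ultimately show ?case by blast
qed

lemma gauss_ints_unit:
  assumes "a \<in> gauss_ints" "b \<in> gauss_ints" "a * b = 1"
  shows "a ^ 4 = 1"
proof -
  obtain c d where a: "a = Complex (of_int c) (of_int d)" using gauss_intsE assms(1) by blast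
  obtain e f where b: "b = Complex (of_int e) (of_int f)" using gauss_intsE assms(2) by blast
  have "of_int (c\<^sup>2 + d\<^sup>2) * of_int (e\<^sup>2 + f\<^sup>2) = (norm a)\<^sup>2 * (norm b)\<^sup>2"
    by (simp add: a b cmod_power2)
  also have "\<dots> = (norm (a * b))\<^sup>2" by (simp add: norm_mult power_mult_distrib)
  also have "\<dots> = 1" using assms(3) by simp
  finally have "(c\<^sup>2 + d\<^sup>2) * (e\<^sup>2 + f\<^sup>2) = 1" by (metis of_int_eq_1_iff of_int_mult)
  moreover have c0: "c\<^sup>2 \<ge> 0" and d0: "d\<^sup>2 \<ge> 0" by simp_all
  ultimately have cd: "c\<^sup>2 + d\<^sup>2 = 1" by (auto simp: zmult_eq_1_iff)
  have "c\<^sup>2 = 1 \<and> d\<^sup>2 = 0 \<or> c\<^sup>2 = 0 \<and> d\<^sup>2 = 1" using cd c0 d0 by arith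
  then have "c = 1 \<and> d = 0 \<or> c = -1 \<and> d = 0 \<or> c = 0 \<and> d = 1 \<or> c = 0 \<and> d = -1"
    by (auto simp: power2_eq_1_iff)
  then have "a = 1 \<or> a = -1 \<or> a = \<i> \<or> a = -\<i>" by (auto simp: a complex_eq_iff)
  then show ?thesis by (auto simp: power4_eq_xxxx)
qed

text \<open>\<open>A\<close> and \<open>cnj A\<close> are coprime with product \<open>z ^ p\<close>,
  so \<open>A\<close> is a unit times the \<open>p\<close>-th power of the gcd of \<open>A\<close>
  and \<open>z\<close>. For odd \<open>p\<close> the unit is itself a \<open>p\<close>-th
  power.\<close>

lemma odd_sum_squares_eq_power:
  fixes a b y :: int
  assumes cop: "coprime a b" and eq: "a\<^sup>2 + b\<^sup>2 = y ^ p" and "odd y" "odd p"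
  shows "\<exists>u v. Complex (of_int a) (of_int b) = Complex (of_int u) (of_int v) ^ p"
proof -
  define A where "A = Complex (of_int a) (of_int b)"
  define z :: complex where "z = of_int y"
  have A: "A \<in> gauss_ints" "cnj A \<in> gauss_ints" "z \<in> gauss_ints" by (auto simp: A_def z_def)
  have AA: "A * cnj A = z ^ p"
  proof -
    have "A * cnj A = of_int (a\<^sup>2 + b\<^sup>2)"
      by (simp add: A_def complex_eq_iff power2_eq_square)
    then show ?thesis by (simp add: eq z_def)
  qed
  have "odd (a\<^sup>2 + b\<^sup>2)" using eq \<open>odd y\<close> by simp
  then have A0: "A \<noteq> 0" by (auto simp: A_def complex_eq_iff)
  obtain t where t: "y ^ p = 2 * t + 1" using \<open>odd y\<close> by (metis oddE even_power)
  \<comment> \<open>Coprimality of \<open>a\<close> and \<open>b\<close> puts 2 into the ideal of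
    \<open>A\<close> and \<open>cnj A\<close>; the odd number \<open>A * cnj A = 2 t + 1\<close>
    then puts 1 into it.\<close>
  obtain c e where ce: "c * a + e * b = 1" using cop by (metis bezout_int coprime_iff_gcd_eq_1)
  define \<mu>0 where "\<mu>0 = of_int c - \<i> * of_int e"
  define \<nu>0 where "\<nu>0 = of_int c + \<i> * of_int e"
  have "2 = 2 * of_int (c * a + e * b)" using ce by simp
  also have "\<dots> = \<mu>0 * A + \<nu>0 * cnj A"
    by (simp add: \<mu>0_def \<nu>0_def A_def complex_eq_iff algebra_simps)
  finally have two: "2 = \<mu>0 * A + \<nu>0 * cnj A" .
  define \<mu> where "\<mu> = - (of_int t * \<mu>0)"
  define \<nu> where "\<nu> = A - of_int t * \<nu>0"
  have \<mu>\<nu>: "\<mu> \<in> gauss_ints" "\<nu> \<in> gauss_ints"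
    unfolding \<mu>_def \<nu>_def \<mu>0_def \<nu>0_def using A
    by (intro gauss_ints_minus gauss_ints_mult gauss_ints_diff gauss_ints_add gauss_ints_of_int gauss_ints_i; simp)+
  have one: "\<mu> * A + \<nu> * cnj A = 1"
  proof -
    have "\<mu> * A + \<nu> * cnj A = A * cnj A - of_int t * (\<mu>0 * A + \<nu>0 * cnj A)"
      by (simp add: \<mu>_def \<nu>_def algebra_simps)
    also have "\<dots> = of_int (y ^ p) - of_int t * 2" using AA two by (simp add: z_def)
    finally show ?thesis by (simp add: t)
  qed
  \<comment> \<open>The Bezout identity raised to the power \<open>p - 1\<close> and multiplied by
    \<open>A\<close> writes \<open>A\<close> as a combination of \<open>A * cnj A = z ^ p\<close>
    and \<open>A ^ p\<close>, both divisible by \<open>g ^ p\<close>.\<close>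
  obtain k where k: "k \<in> gauss_ints" "(\<nu> * cnj A + \<mu> * A) ^ (p - 1) = (\<nu> * cnj A) * k + (\<mu> * A) ^ (p - 1)"
    using gauss_ints_power_add[of "\<nu> * cnj A" "\<mu> * A"] \<mu>\<nu> A by blast
  then have k1: "1 = (\<nu> * cnj A) * k + (\<mu> * A) ^ (p - 1)" using one by (simp add: add.commute)
  have p0: "A * A ^ (p - 1) = A ^ p" using \<open>odd p\<close> by (cases p) auto
  obtain \<rho> \<sigma> A' z' where g: "\<rho> \<in> gauss_ints" "\<sigma> \<in> gauss_ints" "A' \<in> gauss_ints" "z' \<in> gauss_ints"
     "A = (\<rho> * A + \<sigma> * z) * A'" "z = (\<rho> * A + \<sigma> * z) * z'"
    using gauss_ints_bezout[OF A(1,3)] by (elim bexE conjE) (rule that)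
  define g where "g = \<rho> * A + \<sigma> * z"
  have gz: "g \<in> gauss_ints" unfolding g_def using g A by auto
  have gA: "A = g * A'" and gz': "z = g * z'" using g unfolding g_def by simp_all
  have "A = A * ((\<nu> * cnj A) * k + (\<mu> * A) ^ (p - 1))" using k1 by simp
  also have "\<dots> = \<nu> * k * (A * cnj A) + \<mu> ^ (p - 1) * (A * A ^ (p - 1))"
    by (simp add: algebra_simps power_mult_distrib)
  also have "\<dots> = \<nu> * k * (g * z') ^ p + \<mu> ^ (p - 1) * (g * A') ^ p"
    unfolding p0 AA gA [symmetric] gz' [symmetric] ..
  also have "\<dots> = g ^ p * (\<nu> * k * z' ^ p + \<mu> ^ (p - 1) * A' ^ p)"
    by (simp add: algebra_simps power_mult_distrib)
  finally have 1: "A = g ^ p * (\<nu> * k * z' ^ p + \<mu> ^ (p - 1) * A' ^ p)" .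
  define \<epsilon> where "\<epsilon> = \<nu> * k * z' ^ p + \<mu> ^ (p - 1) * A' ^ p"
  have \<epsilon>: "\<epsilon> \<in> gauss_ints" unfolding \<epsilon>_def using \<mu>\<nu> g k by auto
  \<comment> \<open>Conversely \<open>A\<close> divides \<open>g ^ p\<close>, because
    \<open>g = \<rho> * A + \<sigma> * z\<close> and \<open>z ^ p = A * cnj A\<close>. Hence the
    cofactor \<open>\<epsilon>\<close> is a unit.\<close>
  obtain l where l: "l \<in> gauss_ints" "g ^ p = (\<rho> * A) * l + (\<sigma> * z) ^ p"
    using gauss_ints_power_add[of "\<rho> * A" "\<sigma> * z" p] g A unfolding g_def by blast
  have "g ^ p = A * (\<rho> * l + \<sigma> ^ p * cnj A)"
    unfolding l(2) power_mult_distrib AA [symmetric] by (simp add: algebra_simps)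
  moreover have Ae: "A = g ^ p * \<epsilon>" using 1 unfolding \<epsilon>_def .
  ultimately have "A * 1 = A * ((\<rho> * l + \<sigma> ^ p * cnj A) * \<epsilon>)" by (metis mult.assoc mult_1_right)
  then have "\<epsilon> * (\<rho> * l + \<sigma> ^ p * cnj A) = 1" using A0 by (simp add: mult.commute)
  moreover have "\<rho> * l + \<sigma> ^ p * cnj A \<in> gauss_ints" using g l A by auto
  ultimately have e4: "\<epsilon> ^ 4 = 1" using gauss_ints_unit \<epsilon> by blast
  obtain j where j: "p = 2 * j + 1" using \<open>odd p\<close> oddE by blast
  \<comment> \<open>As \<open>p * p\<close> is 1 modulo 4, \<open>\<epsilon>\<close> is the
    \<open>p\<close>-th power of \<open>\<epsilon> ^ p\<close>.\<close>
  have "p * p = 4 * (j * j + j) + 1" by (simp add: j algebra_simps)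
  then have "\<epsilon> ^ (p * p) = (\<epsilon> ^ 4) ^ (j * j + j) * \<epsilon>" by (simp only: power_add power_mult power_one_right)
  then have "\<epsilon> ^ (p * p) = \<epsilon>" using e4 by simp
  then have "A = (\<epsilon> ^ p * g) ^ p"
    using Ae unfolding power_mult_distrib power_mult [symmetric] by (simp add: mult.commute)
  moreover have "\<epsilon> ^ p * g \<in> gauss_ints" using \<epsilon> gz by auto
  ultimately show ?thesis unfolding A_def by (metis gauss_intsE)
qed

section \<open>Gauss periods and the norm form of the cyclotomic polynomial\<close>

lemma prod_roots_unity_diff:
  fixes x y :: complex
  assumes "n > 0"
  shows "(\<Prod>z | z ^ n = 1. x - z * y) = x ^ n - y ^ n"
proof (cases "y = 0")
  case True
  have "card {z::complex. z ^ n = 1} = n" using card_roots_unity_eq assms by simp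
  then show ?thesis using True assms by (simp add: power_0_left)
next
  case False
  define q :: "complex poly" where "q = monom 1 n - 1"
  have q: "poly q z = z ^ n - 1" for z by (simp add: q_def poly_monom)
  have q': "poly (pderiv q) z = of_nat n * z ^ (n - 1)" for z
    by (simp add: q_def pderiv_diff pderiv_monom poly_monom)
  have deg: "degree q = n" "lead_coeff q = 1"
  proof -
    have "degree (1::complex poly) < degree (monom 1 n :: complex poly)"
      using assms by (simp add: degree_monom_eq)
    then show "degree q = n"
      unfolding q_def diff_conv_add_uminus by (subst degree_add_eq_left) (simp_all add: degree_monom_eq)
    then show "lead_coeff q = 1" using assms by (simp add: q_def)
  qed
  have "rsquarefree q"
    unfolding rsquarefree_roots q q' using assms by (auto simp: power_0_left)
  then have "q = (\<Prod>z | z ^ n = 1. [:- z, 1:])"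
    using complex_poly_decompose_rsquarefree[of q] deg by (simp add: q)
  then have "poly q (x / y) = (\<Prod>z | z ^ n = 1. x / y - z)"
    by (simp add: poly_prod)
  then have "y ^ n * (\<Prod>z | z ^ n = 1. x / y - z) = x ^ n - y ^ n"
    using False by (simp add: q power_divide field_simps)
  moreover have "y ^ n * (\<Prod>z | z ^ n = 1. x / y - z) = (\<Prod>z | z ^ n = 1. y * (x / y - z))"
    using card_roots_unity_eq[OF assms] by (simp add: prod.distrib)
  moreover have "y * (x / y - z) = x - z * y" for z using False by (simp add: field_simps)
  ultimately show ?thesis by simp
qed

text \<open>The powers of \<open>w\<close> sum to 0, so \<open>n\<close> is the sum of all
  \<open>1 - w ^ k\<close>, and each of these has norm at most
  \<open>k * norm (1 - w)\<close>.\<close>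

lemma norm_one_minus_root_unity:
  fixes w :: complex
  assumes "w ^ n = 1" "w \<noteq> 1" "n > 0"
  shows "norm (1 - w) \<ge> 2 / real n"
proof -
  have nw: "norm w = 1" using assms by (metis norm_one norm_power power_eq_1_iff norm_ge_zero neq0_conv)
  have b: "norm (1 - w ^ k) \<le> real k * norm (1 - w)" for k
  proof (induction k)
    case 0
    then show ?case by simp
  next
    case (Suc k)
    have "norm (1 - w ^ Suc k) = norm ((1 - w ^ k) + w ^ k * (1 - w))" by (simp add: algebra_simps)
    also have "\<dots> \<le> norm (1 - w ^ k) + norm (1 - w)"
      by (rule norm_triangle_le) (simp add: norm_mult norm_power nw)
    finally show ?case using Suc by (simp add: algebra_simps)
  qed
  have "(\<Sum>k<n. w ^ k) = 0" using assms by (simp add: sum_gp_strict)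
  then have "of_nat n = (\<Sum>k<n. 1 - w ^ k)" by (simp add: sum_subtractf)
  then have "real n = norm (\<Sum>k<n. 1 - w ^ k)" by (metis norm_of_nat)
  also have "\<dots> \<le> (\<Sum>k<n. norm (1 - w ^ k))" by (rule norm_sum)
  also have "\<dots> \<le> (\<Sum>k<n. real k * norm (1 - w))" by (intro sum_mono b)
  also have "\<dots> = (\<Sum>k<n. real k) * norm (1 - w)" by (simp add: sum_distrib_right)
  also have "(\<Sum>k<n. real k) = real n * (real n - 1) / 2"
    by (induction n) (simp_all add: field_simps)
  finally have "real n \<le> real n * (real n - 1) / 2 * norm (1 - w)" .
  also have "\<dots> \<le> real n * real n / 2 * norm (1 - w)"
    by (intro mult_right_mono divide_right_mono mult_left_mono) auto
  finally show ?thesis using assms(3) by (simp add: field_simps)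
qed

section \<open>Additive characters and quadratic residues modulo \<open>p\<close>\<close>

locale gauss_period =
  fixes p :: nat
  assumes prime_p: "prime p" and p_mod_4: "p mod 4 = 3" and p_gt_3: "p > 3"
begin

definition e :: "int \<Rightarrow> complex" where
  "e a = cis (2 * pi * of_int a / of_nat p)"

definition R :: "int set" where
  "R = {a \<in> {0..<int p}. Legendre a (int p) = 1}"

lemma p0: "p > 0" using p_gt_3 by simp

lemma e_add: "e (a + b) = e a * e b"
  by (simp add: e_def cis_mult add_divide_distrib distrib_left)

lemma e_0 [simp]: "e 0 = 1" by (simp add: e_def)

lemma cnj_e [simp]: "cnj (e a) = e (- a)" by (simp add: e_def cis_cnj)

lemma norm_e [simp]: "norm (e a) = 1" by (simp add: e_def)

lemma e_sum: "finite A \<Longrightarrow> e (\<Sum>a\<in>A. f a) = (\<Prod>a\<in>A. e (f a))"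
  by (induction A rule: finite_induct) (auto simp: e_add)

lemma e_eq_1_iff: "e a = 1 \<longleftrightarrow> int p dvd a"
proof
  assume "e a = 1"
  then have "cos (2 * pi * of_int a / of_nat p) = 1" by (simp add: e_def complex_eq_iff)
  then obtain k :: int where "2 * pi * of_int a / of_nat p = of_int k * 2 * pi"
    by (auto simp: cos_one_2pi_int)
  then have "of_int a = (of_int (k * int p) :: real)" using p0 by (simp add: field_simps)
  then have "a = k * int p" by (simp only: of_int_eq_iff)
  then show "int p dvd a" by simp
next
  assume "int p dvd a"
  then obtain k where "a = int p * k" by auto
  then have "2 * pi * of_int a / of_nat p = 2 * pi * of_int k" using p0 by simp
  then show "e a = 1" unfolding e_def by (metis Ints_of_int cis_multiple_2pi)
qed

lemma e_eq_iff: "e a = e b \<longleftrightarrow> [a = b] (mod int p)"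
proof -
  have "e a = e (a - b) * e b" by (simp flip: e_add)
  moreover have "e b \<noteq> 0" by (metis norm_e norm_zero zero_neq_one)
  ultimately have "e a = e b \<longleftrightarrow> e (a - b) = 1" by simp
  then show ?thesis by (simp add: e_eq_1_iff cong_iff_dvd_diff)
qed

lemma e_mod [simp]: "e (a mod int p) = e a"
  by (simp add: e_eq_iff)

lemma e_power_p: "e a ^ p = 1"
proof -
  have "e a ^ n = e (int n * a)" for n
    by (induction n) (simp_all add: e_add distrib_right)
  then show ?thesis by (simp add: e_eq_1_iff)
qed

lemma e_bij: "bij_betw e {0..<int p} {z. z ^ p = 1}"
proof -
  have inj: "inj_on e {0..<int p}" by (auto simp: inj_on_def e_eq_iff cong_def)
  have "card (e ` {0..<int p}) = p" using card_image[OF inj] by simp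
  moreover have "card {z::complex. z ^ p = 1} = p" using card_roots_unity_eq p0 by blast
  moreover have "e ` {0..<int p} \<subseteq> {z. z ^ p = 1}" using e_power_p by auto
  moreover have "finite {z::complex. z ^ p = 1}" using finite_roots_unity[of p] p0 by simp
  ultimately have "e ` {0..<int p} = {z. z ^ p = 1}" by (metis card_subset_eq)
  then show ?thesis using inj by (simp add: bij_betw_def)
qed

lemma sum_e: "(\<Sum>c\<in>{0..<int p}. e c) = 0"
  using sum.reindex_bij_betw[OF e_bij, of "\<lambda>z. z"] sum_roots_unity[of p] p_gt_3 by simp

lemma prod_e: "(\<Prod>c\<in>{0..<int p}. x - e c * y) = x ^ p - y ^ p"
  using prod.reindex_bij_betw[OF e_bij, of "\<lambda>z. x - z * y"] prod_roots_unity_diff[OF p0] by simp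

lemma prime_int_p: "prime (int p)" using prime_p by simp

lemma Legendre_cong: "[a = b] (mod int p) \<Longrightarrow> Legendre a (int p) = Legendre b (int p)"
proof -
  assume "[a = b] (mod int p)"
  then have "[a = 0] (mod int p) \<longleftrightarrow> [b = 0] (mod int p)" "\<And>y. [y = a] (mod int p) \<longleftrightarrow> [y = b] (mod int p)"
    by (simp_all add: cong_def)
  then show ?thesis by (simp add: Legendre_def QuadRes_def)
qed

lemma Legendre_values: "Legendre a (int p) \<in> {-1, 0, 1}" by (auto simp: Legendre_def)

text \<open>Two numbers among -1, 0, 1 differ by at most 2, less than \<open>p\<close>, so a
  congruence between them is an equality.\<close>

lemma Legendre_eqI:
  assumes "[Legendre a (int p) = b] (mod int p)" "b \<in> {-1, 0, 1}"
  shows "Legendre a (int p) = b"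
proof -
  have "int p dvd Legendre a (int p) - b" using assms by (simp add: cong_iff_dvd_diff)
  moreover have "\<bar>Legendre a (int p) - b\<bar> \<le> 2" using Legendre_values[of a] assms(2) by auto
  ultimately show ?thesis
    using p_gt_3 dvd_imp_le_int[of "Legendre a (int p) - b" "int p"] by fastforce
qed

lemma euler: "[Legendre a (int p) = a ^ ((p - 1) div 2)] (mod int p)"
  using euler_criterion[of p a] prime_p p_gt_3 by simp

lemma Legendre_mult: "Legendre (a * b) (int p) = Legendre a (int p) * Legendre b (int p)"
proof (rule Legendre_eqI)
  have "[Legendre (a * b) (int p) = a ^ ((p - 1) div 2) * b ^ ((p - 1) div 2)] (mod int p)"
    using euler[of "a * b"] by (simp add: power_mult_distrib)
  also have "[a ^ ((p - 1) div 2) * b ^ ((p - 1) div 2) = Legendre a (int p) * Legendre b (int p)] (mod int p)"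
    by (intro cong_mult cong_sym[OF euler])
  finally show "[Legendre (a * b) (int p) = Legendre a (int p) * Legendre b (int p)] (mod int p)" .
  show "Legendre a (int p) * Legendre b (int p) \<in> {-1, 0, 1}"
    using Legendre_values[of a] Legendre_values[of b] by auto
qed

lemma odd_half: "odd ((p - 1) div 2)"
  using p_mod_4 by presburger

text \<open>For \<open>p\<close> congruent to 3 modulo 4 the number -1 is a non-residue. Hence the
  non-residues are exactly the negatives of the elements of \<open>R\<close>.\<close>

lemma Legendre_minus: "Legendre (- a) (int p) = - Legendre a (int p)"
proof (rule Legendre_eqI)
  have "[Legendre (- a) (int p) = - (a ^ ((p - 1) div 2))] (mod int p)"
    using euler[of "- a"] odd_half by simp
  also have "[- (a ^ ((p - 1) div 2)) = - Legendre a (int p)] (mod int p)"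
    using cong_sym[OF euler[of a]] by (simp add: cong_minus_minus_iff)
  finally show "[Legendre (- a) (int p) = - Legendre a (int p)] (mod int p)" .
  show "- Legendre a (int p) \<in> {-1, 0, 1}"
    using Legendre_values[of a] by auto
qed

lemma Legendre_0_iff: "Legendre a (int p) = 0 \<longleftrightarrow> int p dvd a"
  by (auto simp: Legendre_def cong_0_iff)

lemma finite_R [simp]: "finite R"
  by (rule finite_subset[of _ "{0..<int p}"]) (auto simp: R_def)

lemma R_coprime: "a \<in> R \<Longrightarrow> coprime a (int p)"
  using prime_imp_coprime[OF prime_int_p, of a] Legendre_0_iff[of a]
  by (auto simp: R_def coprime_commute)

lemma residues_partition:
  "{0..<int p} = insert 0 (R \<union> (\<lambda>a. int p - a) ` R)"
  "0 \<notin> R \<union> (\<lambda>a. int p - a) ` R" "R \<inter> (\<lambda>a. int p - a) ` R = {}"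
proof -
  have L0: "Legendre 0 (int p) = 0" by (simp add: Legendre_0_iff)
  have L: "Legendre (int p - a) (int p) = - Legendre a (int p)" for a
    using Legendre_cong[of "int p - a" "- a"] by (simp add: Legendre_minus cong_iff_dvd_diff)
  show "0 \<notin> R \<union> (\<lambda>a. int p - a) ` R" using L0 by (auto simp: R_def)
  show "R \<inter> (\<lambda>a. int p - a) ` R = {}" using L by (auto simp: R_def)
  show "{0..<int p} = insert 0 (R \<union> (\<lambda>a. int p - a) ` R)"
  proof (intro equalityI subsetI)
    fix c assume c: "c \<in> {0..<int p}"
    show "c \<in> insert 0 (R \<union> (\<lambda>a. int p - a) ` R)"
    proof (cases "c = 0")
      case False
      then have "\<not> int p dvd c" using c zdvd_imp_le[of "int p" c] by auto
      then have "Legendre c (int p) = 1 \<or> Legendre c (int p) = -1"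
        using Legendre_values[of c] Legendre_0_iff[of c] by auto
      then show ?thesis
      proof
        assume "Legendre c (int p) = -1"
        then have "int p - c \<in> R" using c False L by (auto simp: R_def)
        then show ?thesis by (metis (no_types, lifting) UnI2 diff_diff_eq2 add_diff_cancel_left' image_eqI insertI2)
      qed (use c in \<open>simp add: R_def\<close>)
    qed simp
  next
    fix c assume c: "c \<in> insert 0 (R \<union> (\<lambda>a. int p - a) ` R)"
    show "c \<in> {0..<int p}"
    proof -
      have "a > 0" if "a \<in> R" for a using that L0 by (cases "a = 0") (auto simp: R_def)
      then show ?thesis using c p0 by (auto simp: R_def)
    qed
  qed
qed

lemma sum_residues:
  fixes f :: "int \<Rightarrow> 'a :: comm_monoid_add"
  shows "(\<Sum>c\<in>{0..<int p}. f c) = f 0 + ((\<Sum>a\<in>R. f a) + (\<Sum>a\<in>R. f (int p - a)))"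
proof -
  have "(\<Sum>c\<in>{0..<int p}. f c) = f 0 + sum f (R \<union> (\<lambda>a. int p - a) ` R)"
    unfolding residues_partition(1) by (rule sum.insert) (use residues_partition(2) in auto)
  also have "sum f (R \<union> (\<lambda>a. int p - a) ` R) = sum f R + sum f ((\<lambda>a. int p - a) ` R)"
    by (rule sum.union_disjoint) (use residues_partition(3) in auto)
  also have "sum f ((\<lambda>a. int p - a) ` R) = (\<Sum>a\<in>R. f (int p - a))"
    by (subst sum.reindex) (auto simp: inj_on_def)
  finally show ?thesis .
qed

lemma prod_residues:
  fixes f :: "int \<Rightarrow> 'a :: comm_monoid_mult"
  shows "(\<Prod>c\<in>{0..<int p}. f c) = f 0 * ((\<Prod>a\<in>R. f a) * (\<Prod>a\<in>R. f (int p - a)))"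
proof -
  have "(\<Prod>c\<in>{0..<int p}. f c) = f 0 * prod f (R \<union> (\<lambda>a. int p - a) ` R)"
    unfolding residues_partition(1) by (rule prod.insert) (use residues_partition(2) in auto)
  also have "prod f (R \<union> (\<lambda>a. int p - a) ` R) = prod f R * prod f ((\<lambda>a. int p - a) ` R)"
    by (rule prod.union_disjoint) (use residues_partition(3) in auto)
  also have "prod f ((\<lambda>a. int p - a) ` R) = (\<Prod>a\<in>R. f (int p - a))"
    by (subst prod.reindex) (auto simp: inj_on_def)
  finally show ?thesis .
qed

lemma card_R: "card R = (p - 1) div 2"
proof -
  have "p = 1 + (card R + card R)" using sum_residues[of "\<lambda>_. 1 :: nat"] by simp
  then show ?thesis by simp
qed

lemma mult_bij_R:
  assumes "b \<in> R"
  shows "bij_betw (\<lambda>a. (b * a) mod int p) R R"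
proof -
  have b: "coprime b (int p)" by (rule R_coprime[OF assms])
  have inj: "inj_on (\<lambda>a. (b * a) mod int p) R"
  proof (rule inj_onI)
    fix a a' assume a: "a \<in> R" "a' \<in> R" "(b * a) mod int p = (b * a') mod int p"
    then have "[b * a = b * a'] (mod int p)" by (simp add: cong_def)
    then have "[a = a'] (mod int p)" using b cong_mult_lcancel by blast
    then show "a = a'" using a by (auto simp: R_def cong_def)
  qed
  have "(\<lambda>a. (b * a) mod int p) ` R \<subseteq> R"
  proof
    fix c assume "c \<in> (\<lambda>a. (b * a) mod int p) ` R"
    then obtain a where a: "a \<in> R" "c = (b * a) mod int p" by auto
    have "Legendre c (int p) = Legendre (b * a) (int p)"
      by (rule Legendre_cong) (simp add: a cong_def)
    then show "c \<in> R" using a assms p0 by (auto simp: R_def Legendre_mult)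
  qed
  then show ?thesis using inj endo_inj_surj[OF finite_R] by (simp add: bij_betw_def)
qed

lemma one_in_R: "1 \<in> R"
  using p_gt_3 by (auto simp: R_def Legendre_def QuadRes_def cong_0_iff intro!: exI[of _ 1])

section \<open>Quadratic Gauss periods\<close>

definition \<eta> :: complex where "\<eta> = (\<Sum>a\<in>R. e a)"

text \<open>The period over the non-residues, which are the negatives of the residues.\<close>

definition \<eta>' :: complex where "\<eta>' = (\<Sum>a\<in>R. e (- a))"

lemma e_p_minus: "e (int p - a) = e (- a)"
  by (simp add: e_eq_iff cong_iff_dvd_diff)

lemma eta_add: "\<eta> + \<eta>' = -1"
  using sum_e unfolding sum_residues by (simp add: e_p_minus \<eta>_def \<eta>'_def eq_neg_iff_add_eq_0 add.commute)

lemma cnj_eta: "cnj \<eta> = \<eta>'" "cnj \<eta>' = \<eta>"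
  by (simp_all add: \<eta>_def \<eta>'_def)

text \<open>A function invariant under multiplication by residues is constant on the residues and on
  the non-residues.\<close>

lemma orbit_sum:
  fixes f g :: "int \<Rightarrow> complex"
  assumes f: "\<And>a b. [a = b] (mod int p) \<Longrightarrow> f a = f b" and g: "\<And>a b. [a = b] (mod int p) \<Longrightarrow> g a = g b"
    and inv: "\<And>a c. a \<in> R \<Longrightarrow> f (a * c) = f c"
  shows "(\<Sum>c\<in>{0..<int p}. f c * g c) = f 0 * g 0 + f 1 * (\<Sum>a\<in>R. g a) + f (-1) * (\<Sum>a\<in>R. g (- a))"
proof -
  have "f a = f 1" if "a \<in> R" for a using inv[OF that, of 1] by simp
  moreover have "f (int p - a) = f (-1)" if "a \<in> R" for a
    using inv[OF that, of "-1"] f[of "int p - a" "- a"] by (simp add: cong_iff_dvd_diff)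
  moreover have "g (int p - a) = g (- a)" for a
    using g[of "int p - a" "- a"] by (simp add: cong_iff_dvd_diff)
  ultimately show ?thesis unfolding sum_residues by (simp add: sum_distrib_left add.assoc)
qed

text \<open>Multiplication by the square 4 permutes \<open>R\<close>, so the sum is congruent to
  four times itself, and 3 is invertible modulo \<open>p\<close>.\<close>

lemma sum_R_dvd: "int p dvd (\<Sum>a\<in>R. a)"
proof -
  have four: "4 \<in> R"
  proof -
    have "p > 4" using p_gt_3 p_mod_4 by (cases "p = 4") auto
    then show ?thesis using zdvd_imp_le[of "int p" 4]
      by (auto simp: R_def Legendre_def QuadRes_def cong_0_iff intro!: exI[of _ 2])
  qed
  have "(\<Sum>a\<in>R. (4 * a) mod int p) = (\<Sum>a\<in>R. a)"
    using sum.reindex_bij_betw[OF mult_bij_R[OF four], of "\<lambda>a. a"] by simp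
  moreover have "[(\<Sum>a\<in>R. (4 * a) mod int p) = (\<Sum>a\<in>R. 4 * a)] (mod int p)"
    by (rule cong_sum) (simp add: cong_def)
  ultimately have "[(\<Sum>a\<in>R. a) = 4 * (\<Sum>a\<in>R. a)] (mod int p)"
    by (simp add: sum_distrib_left)
  then have "int p dvd 3 * (\<Sum>a\<in>R. a)" by (simp add: cong_iff_dvd_diff cong_sym_eq)
  moreover have "coprime (int p) 3"
    using prime_int_p p_gt_3 zdvd_imp_le[of "int p" 3] by (intro prime_imp_coprime) auto
  ultimately show ?thesis by (simp add: coprime_dvd_mult_right_iff)
qed

section \<open>The cyclotomic form split over residues and non-residues\<close>

definition P :: "complex \<Rightarrow> complex \<Rightarrow> complex" where
  "P x y = (\<Prod>a\<in>R. x - e a * y)"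

definition N :: "complex \<Rightarrow> complex \<Rightarrow> complex" where
  "N x y = (\<Prod>a\<in>R. x - e (- a) * y)"

lemma P_mult_N: "(x - y) * (P x y * N x y) = x ^ p - y ^ p"
  using prod_e[of x y] unfolding prod_residues by (simp add: P_def N_def e_p_minus)

text \<open>Conjugation turns the factor for \<open>a\<close> into \<open>- e (- a)\<close> times
  itself. The roots of unity multiply to 1 by \<open>sum_R_dvd\<close>, and the number of factors is
  odd, which leaves the sign.\<close>

lemma cnj_P: "cnj (P x (cnj x)) = - P x (cnj x)" and cnj_N: "cnj (N x (cnj x)) = - N x (cnj x)"
proof -
  have s: "(\<Prod>a\<in>R. e a) = 1" "(\<Prod>a\<in>R. e (- a)) = 1"
    using sum_R_dvd e_sum[OF finite_R, of "\<lambda>a. a"] e_sum[OF finite_R, of "\<lambda>a. - a"]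
    by (simp_all add: sum_negf e_eq_1_iff[THEN iffD2])
  have "cnj (P x (cnj x)) = (\<Prod>a\<in>R. (- e (- a)) * (x - e a * cnj x))"
    unfolding P_def cnj_prod by (intro prod.cong refl) (simp add: algebra_simps flip: e_add mult.assoc)
  also have "\<dots> = - P x (cnj x)"
    unfolding prod.distrib prod_uminus s card_R P_def using odd_half by simp
  finally show "cnj (P x (cnj x)) = - P x (cnj x)" .
  have "cnj (N x (cnj x)) = (\<Prod>a\<in>R. (- e a) * (x - e (- a) * cnj x))"
    unfolding N_def cnj_prod by (intro prod.cong refl) (simp add: algebra_simps flip: e_add mult.assoc)
  also have "\<dots> = - N x (cnj x)"
    unfolding prod.distrib prod_uminus s card_R N_def using odd_half by simp
  finally show "cnj (N x (cnj x)) = - N x (cnj x)" .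
qed

text \<open>\<open>F x y c\<close> collects the coefficients of \<open>e c\<close> after expanding the product \<open>P x y\<close>.\<close>

definition F :: "complex \<Rightarrow> complex \<Rightarrow> int \<Rightarrow> complex" where
  "F x y c = (\<Sum>S\<in>Pow R. if [\<Sum>S = c] (mod int p) then (-1) ^ card S * (y ^ card S * x ^ (card R - card S)) else 0)"

lemma F_cong: "[a = b] (mod int p) \<Longrightarrow> F x y a = F x y b"
  unfolding F_def by (intro sum.cong refl) (metis cong_sym cong_trans)

text \<open>Multiplication by a residue \<open>b\<close> permutes the subsets of \<open>R\<close>,
  keeps their sizes and multiplies their sums by \<open>b\<close>.\<close>

lemma F_inv:
  assumes "b \<in> R"
  shows "F x y (b * c) = F x y c"
proof -
  let ?h = "\<lambda>a. (b * a) mod int p"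
  have bij: "bij_betw ((`) ?h) (Pow R) (Pow R)" by (rule bij_betw_Pow[OF mult_bij_R[OF assms]])
  have cop: "coprime b (int p)" by (rule R_coprime[OF assms])
  have "F x y (b * c) = (\<Sum>S\<in>Pow R. if [\<Sum>(?h ` S) = b * c] (mod int p)
      then (-1) ^ card (?h ` S) * (y ^ card (?h ` S) * x ^ (card R - card (?h ` S))) else 0)"
    unfolding F_def by (rule sum.reindex_bij_betw[OF bij, symmetric])
  also have "\<dots> = F x y c"
    unfolding F_def
  proof (intro sum.cong refl)
    fix S assume S: "S \<in> Pow R"
    then have inj: "inj_on ?h S" using mult_bij_R[OF assms] by (auto simp: bij_betw_def intro: inj_on_subset)
    have "\<Sum>(?h ` S) = (\<Sum>a\<in>S. ?h a)" using inj by (simp add: sum.reindex)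
    moreover have "[(\<Sum>a\<in>S. ?h a) = (\<Sum>a\<in>S. b * a)] (mod int p)"
      by (rule cong_sum) (simp add: cong_def)
    ultimately have "[\<Sum>(?h ` S) = b * \<Sum>S] (mod int p)" by (simp add: sum_distrib_left)
    then have "[\<Sum>(?h ` S) = b * c] (mod int p) \<longleftrightarrow> [b * \<Sum>S = b * c] (mod int p)"
      by (simp add: cong_def)
    also have "\<dots> \<longleftrightarrow> [\<Sum>S = c] (mod int p)" using cop by (simp add: cong_mult_lcancel)
    finally show "(if [\<Sum>(?h ` S) = b * c] (mod int p)
      then (-1) ^ card (?h ` S) * (y ^ card (?h ` S) * x ^ (card R - card (?h ` S))) else 0) =
      (if [\<Sum>S = c] (mod int p) then (-1) ^ card S * (y ^ card S * x ^ (card R - card S)) else 0)"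
      using card_image[OF inj] by simp
  qed
  finally show ?thesis .
qed

text \<open>Expand over subsets of \<open>R\<close>, group by subset sum modulo \<open>p\<close>,
  then apply \<open>orbit_sum\<close>. Stated for a general \<open>g\<close> to cover both
  \<open>e\<close> and its conjugate with the same coefficients \<open>F\<close>.\<close>

lemma prod_expand:
  fixes g :: "int \<Rightarrow> complex"
  assumes g: "\<And>S. S \<subseteq> R \<Longrightarrow> (\<Prod>a\<in>S. g a) = g (\<Sum>S)" and gc: "\<And>a b. [a = b] (mod int p) \<Longrightarrow> g a = g b"
  shows "(\<Prod>a\<in>R. x - g a * y) =
    F x y 0 * g 0 + F x y 1 * (\<Sum>a\<in>R. g a) + F x y (-1) * (\<Sum>a\<in>R. g (- a))"
proof -
  let ?w = "\<lambda>S. (-1) ^ card S * (y ^ card S * x ^ (card R - card S))"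
  have "(\<Prod>a\<in>R. x - g a * y) = (\<Sum>S\<in>Pow R. ?w S * g (\<Sum>S))"
    unfolding prod_diff_conv_sum[OF finite_R]
  proof (intro sum.cong refl)
    fix S assume S: "S \<in> Pow R"
    then have "card (R - S) = card R - card S" using card_Diff_subset finite_subset[OF _ finite_R] by auto
    then show "(- 1) ^ card S * (\<Prod>a\<in>S. g a * y) * (\<Prod>a\<in>R - S. x) = ?w S * g (\<Sum>S)"
      using g[of S] S by (simp add: prod.distrib)
  qed
  also have "\<dots> = (\<Sum>S\<in>Pow R. \<Sum>c\<in>{0..<int p}. if [\<Sum>S = c] (mod int p) then ?w S * g c else 0)"
  proof (intro sum.cong refl)
    fix S
    have "(\<Sum>c\<in>{0..<int p}. if [\<Sum>S = c] (mod int p) then ?w S * g c else 0) =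
        (\<Sum>c\<in>{0..<int p}. if c = \<Sum>S mod int p then ?w S * g c else 0)"
      by (intro sum.cong refl) (auto simp: cong_def)
    also have "\<dots> = ?w S * g (\<Sum>S mod int p)" using p0 by simp
    also have "\<dots> = ?w S * g (\<Sum>S)" using gc[of "\<Sum>S mod int p" "\<Sum>S"] by (simp add: cong_def)
    finally show "?w S * g (\<Sum>S) = (\<Sum>c\<in>{0..<int p}. if [\<Sum>S = c] (mod int p) then ?w S * g c else 0)" by simp
  qed
  also have "\<dots> = (\<Sum>c\<in>{0..<int p}. F x y c * g c)"
    unfolding F_def sum_distrib_right by (subst sum.swap) (intro sum.cong refl, simp)
  also have "\<dots> = F x y 0 * g 0 + F x y 1 * (\<Sum>a\<in>R. g a) + F x y (-1) * (\<Sum>a\<in>R. g (- a))"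
    by (rule orbit_sum) (auto intro: F_cong gc F_inv)
  finally show ?thesis .
qed

lemma P_expand: "P x y = F x y 0 + F x y 1 * \<eta> + F x y (-1) * \<eta>'"
proof -
  have "P x y = F x y 0 * e 0 + F x y 1 * (\<Sum>a\<in>R. e a) + F x y (-1) * (\<Sum>a\<in>R. e (- a))"
    unfolding P_def
  proof (rule prod_expand)
    fix S assume "S \<subseteq> R"
    then have "finite S" using finite_subset finite_R by blast
    then show "prod e S = e (\<Sum>S)" using e_sum[of S "\<lambda>a. a"] by simp
  qed (simp add: e_eq_iff)
  then show ?thesis by (simp add: \<eta>_def \<eta>'_def)
qed

lemma N_expand: "N x y = F x y 0 + F x y 1 * \<eta>' + F x y (-1) * \<eta>"
proof -
  have "N x y = F x y 0 * e (- 0) + F x y 1 * (\<Sum>a\<in>R. e (- a)) + F x y (-1) * (\<Sum>a\<in>R. e (- (- a)))"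
    unfolding N_def
  proof (rule prod_expand)
    fix S assume "S \<subseteq> R"
    then have "finite S" using finite_subset finite_R by blast
    then show "(\<Prod>a\<in>S. e (- a)) = e (- \<Sum>S)" using e_sum[of S "\<lambda>a. - a"] by (simp add: sum_negf)
  next
    fix a b assume "[a = b] (mod int p)"
    then show "e (- a) = e (- b)" by (simp add: e_eq_iff cong_minus_minus_iff)
  qed
  then show ?thesis by (simp add: \<eta>_def \<eta>'_def)
qed

section \<open>Orthogonality of characters and the quadratic Gauss sum\<close>

lemma mult_bij_residues:
  assumes "coprime b (int p)"
  shows "bij_betw (\<lambda>a. (b * a) mod int p) {0..<int p} {0..<int p}"
proof -
  have inj: "inj_on (\<lambda>a. (b * a) mod int p) {0..<int p}"
  proof (rule inj_onI)
    fix a a' assume a: "a \<in> {0..<int p}" "a' \<in> {0..<int p}" "(b * a) mod int p = (b * a') mod int p"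
    then have "[b * a = b * a'] (mod int p)" by (simp add: cong_def)
    then have "[a = a'] (mod int p)" using assms cong_mult_lcancel by blast
    then show "a = a'" using a by (auto simp: cong_def)
  qed
  moreover have "(\<lambda>a. (b * a) mod int p) ` {0..<int p} \<subseteq> {0..<int p}" using p0 by auto
  ultimately show ?thesis by (simp add: bij_betw_def endo_inj_surj)
qed

lemma coprime_p: "\<not> int p dvd k \<Longrightarrow> coprime k (int p)"
  using prime_imp_coprime[OF prime_int_p, of k] by (simp add: coprime_commute)

lemma sum_e_mult: "(\<Sum>d\<in>{0..<int p}. e (k * d)) = (if int p dvd k then of_nat p else 0)"
proof (cases "int p dvd k")
  case True
  then have "e (k * d) = 1" for d by (simp add: e_eq_1_iff)
  then show ?thesis using True by simp
next
  case False
  show ?thesis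
    using sum.reindex_bij_betw[OF mult_bij_residues[OF coprime_p[OF False]], of e] sum_e False by simp
qed

definition G :: complex where "G = \<eta> - \<eta>'"

lemma G_eq: "G = (\<Sum>c\<in>{0..<int p}. of_int (Legendre c (int p)) * e c)"
proof -
  have "Legendre a (int p) = 1" if "a \<in> R" for a using that by (simp add: R_def)
  moreover have "Legendre (int p - a) (int p) = -1" if "a \<in> R" for a
    using that Legendre_cong[of "int p - a" "- a"] Legendre_minus[of a]
    by (simp add: R_def cong_iff_dvd_diff)
  moreover have "Legendre 0 (int p) = 0" by (simp add: Legendre_0_iff)
  ultimately show ?thesis
    unfolding sum_residues by (simp add: e_p_minus G_def \<eta>_def \<eta>'_def sum_negf)
qed

lemma sum_Legendre: "(\<Sum>c\<in>{0..<int p}. Legendre c (int p)) = 0"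
proof -
  have "Legendre a (int p) = 1" if "a \<in> R" for a using that by (simp add: R_def)
  moreover have "Legendre (int p - a) (int p) = -1" if "a \<in> R" for a
    using that Legendre_cong[of "int p - a" "- a"] Legendre_minus[of a]
    by (simp add: R_def cong_iff_dvd_diff)
  moreover have "Legendre 0 (int p) = 0" by (simp add: Legendre_0_iff)
  ultimately show ?thesis unfolding sum_residues by simp
qed

lemma cnj_G: "cnj G = - G" by (simp add: G_def cnj_eta)

text \<open>In \<open>G * cnj G\<close> the substitution \<open>c = d * t\<close> makes the Legendre
  symbols of \<open>d\<close> cancel; summing over \<open>d\<close> first then leaves only
  \<open>t = 1\<close>, by orthogonality. So \<open>G * cnj G = p\<close>, and
  \<open>cnj G = - G\<close>.\<close>

lemma G_square: "G\<^sup>2 = - of_nat p"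
proof -
  let ?I = "{0..<int p}"
  let ?l = "\<lambda>c. of_int (Legendre c (int p)) :: complex"
  have inner: "(\<Sum>c\<in>?I. ?l c * ?l d * e (c - d)) = (\<Sum>t\<in>?I. ?l t * e ((t - 1) * d))" if d: "d \<in> ?I" for d
  \<comment> \<open>The substitution needs \<open>d\<close> invertible. For \<open>d = 0\<close>
    both sides vanish, the right one because the Legendre symbols sum to 0.\<close>
  proof (cases "d = 0")
    case True
    have "(\<Sum>t\<in>?I. ?l t) = of_int (\<Sum>t\<in>?I. Legendre t (int p))" by simp
    then show ?thesis using True sum_Legendre by (simp add: Legendre_0_iff[THEN iffD2])
  next
    case False
    then have nd: "\<not> int p dvd d" using d zdvd_imp_le[of "int p" d] by auto
    then have L: "Legendre d (int p) = 1 \<or> Legendre d (int p) = -1"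
      using Legendre_values[of d] Legendre_0_iff[of d] by auto
    have "(\<Sum>c\<in>?I. ?l c * ?l d * e (c - d)) = (\<Sum>t\<in>?I. ?l (d * t mod int p) * ?l d * e (d * t mod int p - d))"
      by (rule sum.reindex_bij_betw[OF mult_bij_residues[OF coprime_p[OF nd]], symmetric])
    also have "\<dots> = (\<Sum>t\<in>?I. ?l t * e ((t - 1) * d))"
    proof (intro sum.cong refl)
      fix t
      have "Legendre (d * t mod int p) (int p) = Legendre (d * t) (int p)"
        by (rule Legendre_cong) (simp add: cong_def)
      moreover have "e (d * t mod int p - d) = e ((t - 1) * d)"
        by (simp add: e_eq_iff cong_def mod_diff_left_eq algebra_simps)
      ultimately show "?l (d * t mod int p) * ?l d * e (d * t mod int p - d) = ?l t * e ((t - 1) * d)"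
        using L by (auto simp: Legendre_mult)
    qed
    finally show ?thesis .
  qed
  have "- (G\<^sup>2) = G * cnj G" by (simp add: cnj_G power2_eq_square)
  also have "\<dots> = (\<Sum>d\<in>?I. \<Sum>c\<in>?I. ?l c * ?l d * e (c - d))"
  proof -
    have "G * cnj G = (\<Sum>c\<in>?I. \<Sum>d\<in>?I. (?l c * e c) * (?l d * e (- d)))"
      unfolding G_eq cnj_sum by (simp add: sum_product)
    also have "\<dots> = (\<Sum>c\<in>?I. \<Sum>d\<in>?I. ?l c * ?l d * e (c - d))"
      by (intro sum.cong refl) (simp add: e_add mult_ac diff_conv_add_uminus del: add_uminus_conv_diff)
    finally show ?thesis by (subst (asm) sum.swap)
  qed
  also have "\<dots> = (\<Sum>d\<in>?I. \<Sum>t\<in>?I. ?l t * e ((t - 1) * d))" by (intro sum.cong refl inner)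
  also have "\<dots> = (\<Sum>t\<in>?I. ?l t * (\<Sum>d\<in>?I. e ((t - 1) * d)))"
    by (subst sum.swap) (simp add: sum_distrib_left)
  also have "\<dots> = (\<Sum>t\<in>?I. if t = 1 then of_nat p else 0)"
  proof (intro sum.cong refl)
    fix t assume t: "t \<in> ?I"
    have "int p dvd t - 1 \<longleftrightarrow> t = 1"
      using t p_gt_3 dvd_imp_le_int[of "t - 1" "int p"] by fastforce
    moreover have "Legendre 1 (int p) = 1" using one_in_R by (simp add: R_def)
    ultimately show "?l t * (\<Sum>d\<in>?I. e ((t - 1) * d)) = (if t = 1 then of_nat p else 0)"
      unfolding sum_e_mult by auto
  qed
  also have "\<dots> = of_nat p" using p_gt_3 by simp
  finally show ?thesis by (simp add: minus_equation_iff)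
qed

section \<open>Integrality, divisibility by \<open>d\<close>, and bounds for the cyclotomic
  form\<close>

lemma F_gauss_ints: "x \<in> gauss_ints \<Longrightarrow> y \<in> gauss_ints \<Longrightarrow> F x y c \<in> gauss_ints"
  unfolding F_def by (intro gauss_ints_sum) (auto intro!: gauss_ints_mult gauss_ints_power)

lemma P_plus_N: "P x y + N x y = 2 * F x y 0 - F x y 1 - F x y (-1)"
proof -
  have "P x y + N x y = 2 * F x y 0 + F x y 1 * (\<eta> + \<eta>') + F x y (-1) * (\<eta> + \<eta>')"
    unfolding P_expand N_expand by (simp add: algebra_simps)
  then show ?thesis by (simp add: eta_add)
qed

lemma P_minus_N: "P x y - N x y = (F x y 1 - F x y (-1)) * G"
  unfolding P_expand N_expand G_def by (simp add: algebra_simps)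

text \<open>Both \<open>\<alpha>\<close> and \<open>cnj \<alpha>\<close> are congruent to
  \<open>s\<close> modulo \<open>d\<close>, and \<open>F\<close> is homogeneous of degree
  \<open>card R\<close>.\<close>

lemma F_congruent:
  fixes s d :: int
  defines "\<alpha> \<equiv> Complex (of_int s) (of_int d)"
  shows "F \<alpha> (cnj \<alpha>) c - of_int s ^ card R * F 1 1 c \<in> (*) (of_int d) ` gauss_ints"
proof -
  let ?J = "(*) (of_int d :: complex) ` gauss_ints"
  have J0: "0 \<in> ?J" by (rule image_eqI[of _ _ 0]) auto
  have Jsum: "sum f A \<in> ?J" if "\<And>S. S \<in> A \<Longrightarrow> f S \<in> ?J" for f and A :: "int set set"
    using that
  proof (induction A rule: infinite_finite_induct)
    case (insert S A)
    have "f S \<in> ?J" "sum f A \<in> ?J" using insert by auto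
    then obtain u v where uv: "f S = of_int d * u" "u \<in> gauss_ints" "sum f A = of_int d * v" "v \<in> gauss_ints"
      by blast
    have "sum f (insert S A) = of_int d * (u + v)" using insert.hyps uv by (simp add: distrib_left)
    then show ?case using uv(2,4) by blast
  qed (use J0 in auto)
  have a1: "\<alpha> = \<i> * of_int d + of_int s" "cnj \<alpha> = - \<i> * of_int d + of_int s"
    by (simp_all add: \<alpha>_def complex_eq_iff)
  have "F \<alpha> (cnj \<alpha>) c - of_int s ^ card R * F 1 1 c =
    (\<Sum>S\<in>Pow R. (if [\<Sum>S = c] (mod int p) then (-1) ^ card S * (cnj \<alpha> ^ card S * \<alpha> ^ (card R - card S)) else 0) -
     of_int s ^ card R * (if [\<Sum>S = c] (mod int p) then (-1) ^ card S * (1 ^ card S * 1 ^ (card R - card S)) else 0))"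
    unfolding F_def by (simp only: sum_distrib_left sum_subtractf)
  also have "\<dots> \<in> ?J"
  proof (rule Jsum)
    fix S assume "S \<in> Pow R"
    then have le: "card S \<le> card R" using card_mono[OF finite_R] by auto
    obtain k where k: "k \<in> gauss_ints" "cnj \<alpha> ^ card S = (- \<i> * of_int d) * k + of_int s ^ card S"
      using gauss_ints_power_add[of "- \<i> * of_int d" "of_int s" "card S"] a1(2) by auto
    obtain l where l: "l \<in> gauss_ints" "\<alpha> ^ (card R - card S) = (\<i> * of_int d) * l + of_int s ^ (card R - card S)"
      using gauss_ints_power_add[of "\<i> * of_int d" "of_int s" "card R - card S"] a1(1) by auto
    have s: "of_int s ^ card S * of_int s ^ (card R - card S) = (of_int s ^ card R :: complex)"
      using le by (simp flip: power_add)
    define z where "z = (- \<i> * k) * \<alpha> ^ (card R - card S) + of_int s ^ card S * (\<i> * l)"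
    have z: "z \<in> gauss_ints" unfolding z_def \<alpha>_def using k l
      by (intro gauss_ints_add gauss_ints_mult gauss_ints_power gauss_ints_minus) auto
    have "cnj \<alpha> ^ card S * \<alpha> ^ (card R - card S) - of_int s ^ card R =
        (cnj \<alpha> ^ card S - of_int s ^ card S) * \<alpha> ^ (card R - card S) +
        of_int s ^ card S * (\<alpha> ^ (card R - card S) - of_int s ^ (card R - card S))"
      by (simp add: algebra_simps flip: s)
    also have "cnj \<alpha> ^ card S - of_int s ^ card S = (- \<i> * of_int d) * k" using k(2) by simp
    also have "\<alpha> ^ (card R - card S) - of_int s ^ (card R - card S) = (\<i> * of_int d) * l" using l(2) by simp
    also have "(- \<i> * of_int d) * k * \<alpha> ^ (card R - card S) + of_int s ^ card S * ((\<i> * of_int d) * l) = of_int d * z"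
      unfolding z_def by (simp add: algebra_simps)
    finally have eq: "cnj \<alpha> ^ card S * \<alpha> ^ (card R - card S) - of_int s ^ card R = of_int d * z" .
    have "(-1) ^ card S * (cnj \<alpha> ^ card S * \<alpha> ^ (card R - card S)) - of_int s ^ card R * (-1) ^ card S =
        of_int d * ((-1) ^ card S * z)"
      using eq by (simp add: algebra_simps)
    moreover have "(-1) ^ card S * z \<in> gauss_ints" using z by auto
    ultimately show "(if [\<Sum>S = c] (mod int p) then (-1) ^ card S * (cnj \<alpha> ^ card S * \<alpha> ^ (card R - card S)) else 0) -
     of_int s ^ card R * (if [\<Sum>S = c] (mod int p) then (-1) ^ card S * (1 ^ card S * 1 ^ (card R - card S)) else 0) \<in> ?J"
      using J0 by auto
  qed
  finally show ?thesis .
qed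

text \<open>At conjugate arguments \<open>x - y\<close> is \<open>2 * \<i> * d\<close> and
  \<open>x ^ p - y ^ p\<close> is \<open>2 * \<i>\<close> times the imaginary part, so the
  cyclotomic form takes the value \<open>U\<close>.\<close>

lemma P_mult_N_eq:
  fixes s d U :: int
  assumes "d \<noteq> 0" "Im (Complex (of_int s) (of_int d) ^ p) = of_int (d * U)"
  defines "\<alpha> \<equiv> Complex (of_int s) (of_int d)"
  shows "P \<alpha> (cnj \<alpha>) * N \<alpha> (cnj \<alpha>) = of_int U"
proof -
  have "(2 * \<i> * of_int d) * (P \<alpha> (cnj \<alpha>) * N \<alpha> (cnj \<alpha>)) = \<alpha> ^ p - cnj (\<alpha> ^ p)"
    using P_mult_N[of \<alpha> "cnj \<alpha>"] by (simp add: complex_diff_cnj \<alpha>_def complex_eq_iff)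
  also have "\<dots> = 2 * \<i> * of_int (d * U)"
    unfolding complex_diff_cnj using assms(2) by (simp add: \<alpha>_def complex_eq_iff)
  also have "\<dots> = (2 * \<i> * of_int d) * of_int U" by simp
  finally show ?thesis using assms(1) by (metis mult_cancel_left mult_eq_0_iff complex_i_not_zero of_int_eq_0_iff zero_neq_numeral)
qed

text \<open>Gauss's identity \<open>4 \<Phi>\<^sub>p(x, y) = A\<^sup>2 + p B\<^sup>2\<close> at conjugate Gaussian integers, where \<open>A\<close> is purely
  imaginary because it is antisymmetric in \<open>x, y\<close>.\<close>

theorem gauss_norm_form:
  fixes s d U :: int
  assumes d: "d \<noteq> 0" and U: "Im (Complex (of_int s) (of_int d) ^ p) = of_int (d * U)"
  shows "\<exists>X Y. int p * Y\<^sup>2 - X\<^sup>2 = 4 * U \<and> d dvd X \<and>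
    of_int \<bar>X\<bar> \<le> 2 * (2 * norm (Complex (of_int s) (of_int d))) ^ ((p - 1) div 2)"
proof -
  define \<alpha> where "\<alpha> = Complex (of_int s) (of_int d)"
  have \<alpha>: "\<alpha> \<in> gauss_ints" "cnj \<alpha> \<in> gauss_ints" by (auto simp: \<alpha>_def)
  define A where "A = P \<alpha> (cnj \<alpha>) + N \<alpha> (cnj \<alpha>)"
  define B where "B = F \<alpha> (cnj \<alpha>) 1 - F \<alpha> (cnj \<alpha>) (-1)"
  have "cnj A = - A" by (simp add: A_def cnj_P cnj_N)
  then have ReA: "Re A = 0" by (simp add: complex_eq_iff)
  have G0: "G \<noteq> 0" using G_square p0 by auto
  have BG: "P \<alpha> (cnj \<alpha>) - N \<alpha> (cnj \<alpha>) = B * G" by (simp add: B_def P_minus_N)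
  then have "cnj (B * G) = - (B * G)" by (simp add: cnj_P cnj_N flip: BG)
  \<comment> \<open>\<open>B * G\<close> and \<open>G\<close> are both purely imaginary, so
    \<open>B\<close> is real and hence an ordinary integer.\<close>
  then have "cnj B = B" using G0 by (simp add: cnj_G)
  then have ImB: "Im B = 0" by (simp add: complex_eq_iff)
  have "B \<in> gauss_ints" unfolding B_def using \<alpha> by (intro gauss_ints_diff F_gauss_ints)
  then obtain Y where Y: "B = of_int Y"
    using ImB by (auto elim!: gauss_intsE simp: complex_eq_iff)
  \<comment> \<open>At \<open>x = y = 1\<close> the sum \<open>P + N\<close> is invariant under
    conjugation and also changes sign, so it is 0. With \<open>F_congruent\<close> this makes
    \<open>A\<close> divisible by \<open>d\<close>.\<close>
  have N1: "N 1 1 = cnj (P 1 1)" by (simp add: N_def P_def)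
  have X11: "2 * F 1 1 0 - F 1 1 1 - F 1 1 (-1) = 0"
    unfolding P_plus_N [symmetric] N1 using cnj_P[of 1] by simp
  define s' where "s' = (of_int s ^ card R :: complex)"
  obtain z0 where z0: "z0 \<in> gauss_ints" "F \<alpha> (cnj \<alpha>) 0 - s' * F 1 1 0 = of_int d * z0"
    using F_congruent[of s d 0] unfolding \<alpha>_def s'_def by blast
  obtain z1 where z1: "z1 \<in> gauss_ints" "F \<alpha> (cnj \<alpha>) 1 - s' * F 1 1 1 = of_int d * z1"
    using F_congruent[of s d 1] unfolding \<alpha>_def s'_def by blast
  obtain z2 where z2: "z2 \<in> gauss_ints" "F \<alpha> (cnj \<alpha>) (-1) - s' * F 1 1 (-1) = of_int d * z2"
    using F_congruent[of s d "-1"] unfolding \<alpha>_def s'_def by blast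
  have "A = 2 * (F \<alpha> (cnj \<alpha>) 0 - s' * F 1 1 0) - (F \<alpha> (cnj \<alpha>) 1 - s' * F 1 1 1)
      - (F \<alpha> (cnj \<alpha>) (-1) - s' * F 1 1 (-1)) + s' * (2 * F 1 1 0 - F 1 1 1 - F 1 1 (-1))"
    unfolding A_def P_plus_N by (simp add: algebra_simps)
  then have A: "A = of_int d * (2 * z0 - z1 - z2)"
    unfolding z0 z1 z2 X11 by (simp add: algebra_simps)
  have "2 * z0 - z1 - z2 \<in> gauss_ints" using z0 z1 z2 by (intro gauss_ints_diff gauss_ints_mult) auto
  then obtain a b where ab: "2 * z0 - z1 - z2 = Complex (of_int a) (of_int b)" by (rule gauss_intsE)
  define X where "X = d * b"
  have AX: "A = \<i> * of_int X" using ReA unfolding A ab X_def by (auto simp: complex_eq_iff)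
  have "4 * (P \<alpha> (cnj \<alpha>) * N \<alpha> (cnj \<alpha>)) = A\<^sup>2 - (B * G)\<^sup>2"
    unfolding A_def BG [symmetric] by (simp add: power2_eq_square algebra_simps)
  also have "\<dots> = of_int (int p * Y\<^sup>2 - X\<^sup>2)"
    by (simp add: AX Y power_mult_distrib G_square)
  also have "P \<alpha> (cnj \<alpha>) * N \<alpha> (cnj \<alpha>) = of_int U"
    unfolding \<alpha>_def by (rule P_mult_N_eq[OF d U])
  finally have "of_int (4 * U) = (of_int (int p * Y\<^sup>2 - X\<^sup>2) :: complex)" by simp
  then have "int p * Y\<^sup>2 - X\<^sup>2 = 4 * U" by (simp only: of_int_eq_iff)
  moreover have "d dvd X" by (simp add: X_def)
  moreover have "of_int \<bar>X\<bar> \<le> 2 * (2 * norm \<alpha>) ^ card R"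
  proof -
    have f: "norm (\<alpha> - e a * cnj \<alpha>) \<le> 2 * norm \<alpha>" for a
      using norm_triangle_ineq4[of \<alpha> "e a * cnj \<alpha>"] by (simp add: norm_mult)
    have "norm (P \<alpha> (cnj \<alpha>)) \<le> (\<Prod>a\<in>R. 2 * norm \<alpha>)" "norm (N \<alpha> (cnj \<alpha>)) \<le> (\<Prod>a\<in>R. 2 * norm \<alpha>)"
      unfolding P_def N_def prod_norm [symmetric] by (intro prod_mono; use f in simp)+
    moreover have "of_int \<bar>X\<bar> = norm A" by (simp add: AX norm_mult)
    moreover have "norm A \<le> norm (P \<alpha> (cnj \<alpha>)) + norm (N \<alpha> (cnj \<alpha>))"
      unfolding A_def by (rule norm_triangle_ineq)
    ultimately show ?thesis by simp
  qed
  ultimately show ?thesis unfolding \<alpha>_def card_R by blast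
qed

text \<open>Each factor is \<open>s * (1 - e a) + \<i> * d * (1 + e a)\<close>. The lower bound on
  \<open>norm (1 - e a)\<close> makes the first term at least \<open>4 * \<bar>d\<bar>\<close>, and
  the second is at most \<open>2 * \<bar>d\<bar>\<close>, so all \<open>p - 1\<close> factors have
  norm at least 2.\<close>

lemma large_quotient:
  fixes s d U :: int
  assumes d: "d \<noteq> 0" and U: "Im (Complex (of_int s) (of_int d) ^ p) = of_int (d * U)"
    and s: "\<bar>s\<bar> \<ge> 2 * int p * \<bar>d\<bar>"
  shows "\<bar>U\<bar> \<ge> 2 ^ (p - 1)"
proof -
  define \<alpha> where "\<alpha> = Complex (of_int s) (of_int d)"
  have f: "2 \<le> norm (\<alpha> - e a * cnj \<alpha>)" if "\<not> int p dvd a" for a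
  proof -
    have "norm (1 - e a) \<ge> 2 / real p"
      using norm_one_minus_root_unity[OF e_power_p] that p0 by (simp add: e_eq_1_iff)
    then have "real_of_int \<bar>s\<bar> * norm (1 - e a) \<ge> real_of_int (2 * int p * \<bar>d\<bar>) * (2 / real p)"
      using s by (intro mult_mono) (simp_all del: of_int_mult)
    also have "real_of_int (2 * int p * \<bar>d\<bar>) * (2 / real p) = 4 * \<bar>of_int d\<bar>" using p0 by simp
    finally have 1: "norm (of_int s * (1 - e a)) \<ge> 4 * \<bar>of_int d\<bar>" by (simp add: norm_mult)
    have "norm (1 + e a) \<le> 2" using norm_triangle_ineq[of 1 "e a"] by simp
    then have "\<bar>real_of_int d\<bar> * norm (1 + e a) \<le> \<bar>real_of_int d\<bar> * 2" by (intro mult_left_mono) auto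
    then have 2: "norm (- (\<i> * of_int d * (1 + e a))) \<le> 2 * \<bar>of_int d\<bar>" by (simp add: norm_mult)
    have "\<alpha> - e a * cnj \<alpha> = of_int s * (1 - e a) - (- (\<i> * of_int d * (1 + e a)))"
      by (simp add: \<alpha>_def complex_eq_iff algebra_simps)
    then have "norm (\<alpha> - e a * cnj \<alpha>) = norm (of_int s * (1 - e a) - (- (\<i> * of_int d * (1 + e a))))"
      by (rule arg_cong)
    then have "norm (\<alpha> - e a * cnj \<alpha>) \<ge> 4 * \<bar>of_int d\<bar> - 2 * \<bar>of_int d\<bar>"
      using norm_triangle_ineq2[of "of_int s * (1 - e a)" "- (\<i> * of_int d * (1 + e a))"] 1 2 by linarith
    moreover have "1 \<le> \<bar>real_of_int d\<bar>" using d by linarith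
    ultimately show ?thesis by linarith
  qed
  have R: "\<not> int p dvd a" "\<not> int p dvd - a" if "a \<in> R" for a
    using that Legendre_0_iff[of a] by (auto simp: R_def)
  have "(\<Prod>a\<in>R. 2) \<le> norm (P \<alpha> (cnj \<alpha>))" "(\<Prod>a\<in>R. 2) \<le> norm (N \<alpha> (cnj \<alpha>))"
    unfolding P_def N_def prod_norm [symmetric] by (intro prod_mono; use f R in auto)+
  then have "2 ^ card R * 2 ^ card R \<le> norm (P \<alpha> (cnj \<alpha>)) * norm (N \<alpha> (cnj \<alpha>))"
    by (intro mult_mono) auto
  also have "\<dots> = real_of_int \<bar>U\<bar>"
    using P_mult_N_eq[OF d U] by (simp add: \<alpha>_def flip: norm_mult)
  also have "2 ^ card R * 2 ^ card R = (2 ^ (p - 1) :: real)"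
    using p_mod_4 unfolding card_R by (simp flip: power_add) presburger
  finally have "real_of_int (2 ^ (p - 1)) \<le> real_of_int \<bar>U\<bar>" by simp
  then show ?thesis by (simp only: of_int_le_iff)
qed

end

section \<open>The equation\<close>

lemma complex_power_expand:
  fixes s d :: int
  shows "\<exists>k l. Complex (of_int s) (of_int d) ^ Suc n =
    Complex (of_int (s ^ Suc n + d * k)) (of_int (d * (int (Suc n) * s ^ n + d * l)))"
proof (induction n)
  case 0
  show ?case by (intro exI[of _ 0]) simp
next
  case (Suc n)
  then obtain k l where kl: "Complex (of_int s) (of_int d) ^ Suc n =
    Complex (of_int (s ^ Suc n + d * k)) (of_int (d * (int (Suc n) * s ^ n + d * l)))" by blast
  have "Complex (of_int s) (of_int d) ^ Suc (Suc n) =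
      Complex (of_int s) (of_int d) * Complex (of_int (s ^ Suc n + d * k)) (of_int (d * (int (Suc n) * s ^ n + d * l)))"
    by (subst power_Suc) (simp only: kl)
  also have "\<dots> = Complex (of_int (s ^ Suc (Suc n) + d * (s * k - d * (int (Suc n) * s ^ n + d * l))))
      (of_int (d * (int (Suc (Suc n)) * s ^ Suc n + d * (k + s * l))))"
    by (simp add: complex_eq_iff algebra_simps)
  finally show ?case by blast
qed

lemma one_plus_i_power:
  assumes "p mod 8 = (3::nat)"
  shows "(1 + \<i>) ^ p = 2 ^ ((p - 1) div 2) * (-1 + \<i>)"
proof -
  define k where "k = p div 8"
  have p: "p = 8 * k + 3" using assms by (simp add: k_def) presburger
  have "(1 + \<i>) ^ 2 = 2 * \<i>" by (simp add: complex_eq_iff power2_eq_square)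
  then have "((1 + \<i>) ^ 2) ^ 4 = 16" by (simp add: power_mult_distrib)
  then have e8: "(1 + \<i>) ^ 8 = 16" by (simp flip: power_mult)
  have e3: "(1 + \<i>) ^ 3 = 2 * (-1 + \<i>)" by (simp add: complex_eq_iff power3_eq_cube)
  have "(1 + \<i>) ^ p = 16 ^ k * (2 * (-1 + \<i>))"
    unfolding p power_add power_mult e8 e3 ..
  moreover have "(2::complex) ^ ((p - 1) div 2) = 16 ^ k * 2"
    by (simp add: p power_add power_mult)
  ultimately show ?thesis by simp
qed

text \<open>With \<open>q = 3 ^ m\<close>, the number \<open>(X + \<i> q) / (1 + \<i>)\<close> is a
  \<open>p\<close>-th power. The hypothesis on \<open>p\<close> joins \<open>p mod 8 = 3\<close>,
  needed for \<open>(1 + \<i>) ^ p\<close>, with \<open>p mod 3 = 2\<close>, needed to fix the sign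
  of \<open>d\<close>.\<close>

lemma descent:
  fixes p m x y :: nat
  assumes p: "p mod 24 = 11" and m: "m \<ge> 1" and cop: "coprime x y"
    and eq: "x ^ 2 + 3 ^ (2 * m) = 2 * y ^ p"
  shows "\<exists>s. Im (Complex (of_int s) (of_int (3 ^ m)) ^ p) = of_int (3 ^ m * 2 ^ ((p - 1) div 2))"
proof -
  define X where "X = int x"
  define Y where "Y = int y"
  define q :: int where "q = 3 ^ m"
  define h where "h = (p - 1) div 2"
  have p8: "p mod 8 = 3" using p mod_mod_cancel[of 8 24 p] by simp
  have p4: "p mod 4 = 3" using p mod_mod_cancel[of 4 24 p] by simp
  have p3: "p mod 3 = 2" using p mod_mod_cancel[of 3 24 p] by simp
  have odd_p: "odd p" using p mod_mod_cancel[of 2 24 p] by (simp add: odd_iff_mod_2_eq_one)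
  then have p_pos: "p > 0" by (rule odd_pos)
  have eqi: "X\<^sup>2 + q\<^sup>2 = 2 * Y ^ p"
  proof -
    have "int (x ^ 2 + 3 ^ (2 * m)) = int (2 * y ^ p)" using eq by simp
    then show ?thesis by (simp add: X_def Y_def q_def power_mult mult.commute flip: power_mult)
  qed
  have q_odd: "odd q" by (simp add: q_def)
  have q3: "3 dvd q" using m by (simp add: q_def)
  have prime3: "prime (3::int)" by (rule prime_int_numeral_eq[THEN iffD2]) simp
  have X_odd: "odd X"
  proof
    assume "even X"
    then have "odd (X\<^sup>2 + q\<^sup>2)" using q_odd by simp
    then show False unfolding eqi by simp
  qed
  have X3: "\<not> 3 dvd X"
  proof
    assume X: "3 dvd X"
    then have "3 dvd X\<^sup>2 + q\<^sup>2" using q3 by (simp add: power2_eq_square)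
    then have "3 dvd Y ^ p" unfolding eqi using prime3 by (simp add: prime_dvd_mult_iff)
    then have "3 dvd Y" using prime3 prime_dvd_power by blast
    then have "3 dvd gcd X Y" using X by simp
    then show False using cop by (simp add: X_def Y_def)
  qed
  define a where "a = (X + q) div 2"
  define b where "b = (q - X) div 2"
  have a: "2 * a = X + q" and b: "2 * b = q - X" using X_odd q_odd by (simp_all add: a_def b_def)
  have ab: "a + b = q" "a - b = X" using a b by linarith+
  have "4 * (a\<^sup>2 + b\<^sup>2) = (2 * a)\<^sup>2 + (2 * b)\<^sup>2" by (simp add: power_mult_distrib)
  also have "\<dots> = 2 * (X\<^sup>2 + q\<^sup>2)" unfolding a b by (simp add: power2_eq_square algebra_simps)
  finally have abY: "a\<^sup>2 + b\<^sup>2 = Y ^ p" unfolding eqi by simp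
  have "coprime a b"
  proof (rule coprimeI)
    fix c assume c: "c dvd a" "c dvd b"
    then have "c dvd q" "c dvd X" using ab by (metis dvd_add, metis dvd_diff)
    moreover have "coprime 3 X" using prime_imp_coprime[OF prime3 X3] .
    then have "coprime q X" by (simp add: q_def)
    ultimately show "is_unit c" by (meson coprime_common_divisor)
  qed
  moreover have "odd Y"
  proof -
    have "odd (a + b)" using ab q_odd by simp
    then have "odd (a\<^sup>2 + b\<^sup>2)" by simp
    then show ?thesis unfolding abY using p_pos by simp
  qed
  ultimately obtain u v where uv: "Complex (of_int a) (of_int b) = Complex (of_int u) (of_int v) ^ p"
    using odd_sum_squares_eq_power[OF _ abY _ odd_p] by blast
  \<comment> \<open>These are the coordinates of \<open>(1 + \<i>) * cnj (u + \<i> v)\<close>; its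
    \<open>p\<close>-th power has imaginary part \<open>2 ^ h * (a + b)\<close>, which is
    \<open>2 ^ h * q\<close>.\<close>
  define s where "s = u + v"
  define d where "d = u - v"
  have "Complex (of_int s) (of_int d) = (1 + \<i>) * cnj (Complex (of_int u) (of_int v))"
    by (simp add: s_def d_def complex_eq_iff)
  then have "Complex (of_int s) (of_int d) ^ p = (2 ^ h * (-1 + \<i>)) * cnj (Complex (of_int a) (of_int b))"
    by (simp only: power_mult_distrib one_plus_i_power[OF p8] uv complex_cnj_power h_def)
  also have "\<dots> = of_int (2 ^ h) * Complex (of_int (b - a)) (of_int (a + b))"
    by (simp add: complex_eq_iff algebra_simps)
  finally have "Im (Complex (of_int s) (of_int d) ^ p) = Im (of_int (2 ^ h) * Complex (of_int (b - a)) (of_int (a + b)))"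
    by simp
  then have Im: "Im (Complex (of_int s) (of_int d) ^ p) = of_int (2 ^ h * q)"
    unfolding ab(1) by simp
  have uvY: "u\<^sup>2 + v\<^sup>2 = Y"
  proof -
    have "real_of_int (a\<^sup>2 + b\<^sup>2) = (norm (Complex (of_int a) (of_int b)))\<^sup>2" by (simp add: cmod_power2)
    also have "\<dots> = ((norm (Complex (of_int u) (of_int v)))\<^sup>2) ^ p"
      unfolding uv norm_power by (metis mult.commute power_mult)
    also have "\<dots> = of_int ((u\<^sup>2 + v\<^sup>2) ^ p)" by (simp add: cmod_power2)
    finally have "(u\<^sup>2 + v\<^sup>2) ^ p = Y ^ p" unfolding abY by (simp only: of_int_eq_iff)
    then show ?thesis by (rule power_eq_imp_eq_base) (use p_pos in \<open>simp_all add: Y_def\<close>)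
  qed
  have sdY: "s\<^sup>2 + d\<^sup>2 = 2 * Y"
    unfolding uvY [symmetric] s_def d_def by (simp add: power2_eq_square algebra_simps)
  have sq3: "z\<^sup>2 mod 3 = (if 3 dvd z then 0 else 1)" for z :: int
  proof -
    have "z mod 3 = 0 \<or> z mod 3 = 1 \<or> z mod 3 = 2" by presburger
    moreover have "z\<^sup>2 mod 3 = r\<^sup>2 mod 3" if "z mod 3 = r" for r
      using power_mod[of z 3 2] unfolding that by simp
    ultimately show ?thesis unfolding dvd_eq_mod_eq_0 by fastforce
  qed
  have Y3: "Y mod 3 = 2"
  proof -
    have "(X\<^sup>2 + q\<^sup>2) mod 3 = (X\<^sup>2 mod 3 + q\<^sup>2 mod 3) mod 3" by (simp add: mod_add_eq)
    then have 1: "(2 * Y ^ p) mod 3 = 1" unfolding eqi [symmetric] sq3 using X3 q3 by simp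
    then have "Y ^ p mod 3 = 2" by presburger
    moreover have "Y ^ p mod 3 = (Y mod 3) ^ p mod 3" by (simp only: power_mod)
    ultimately have 2: "(Y mod 3) ^ p mod 3 = 2" by simp
    have "Y mod 3 \<noteq> 0"
    proof
      assume "Y mod 3 = 0"
      then show False using 2 p_pos by (simp only:) (simp add: power_0_left)
    qed
    moreover have "Y mod 3 \<noteq> 1"
    proof
      assume "Y mod 3 = 1"
      then show False using 2 by (simp only:) simp
    qed
    ultimately show ?thesis by presburger
  qed
  have sd3: "(s\<^sup>2 mod 3 + d\<^sup>2 mod 3) mod 3 = 1"
  proof -
    have "(s\<^sup>2 mod 3 + d\<^sup>2 mod 3) mod 3 = (2 * Y) mod 3" unfolding sdY [symmetric] by (simp add: mod_add_eq)
    then show ?thesis using Y3 by presburger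
  qed
  obtain n where n: "p = Suc n" using p_pos by (cases p) auto
  have d3: "3 dvd d"
  proof (rule ccontr)
    \<comment> \<open>Exactly one of \<open>s\<close>, \<open>d\<close> is divisible by 3. Were it
      \<open>s\<close>, expanding \<open>\<i> * (d - \<i> s)\<close> would make the imaginary part
      congruent to \<open>- (d ^ p)\<close> modulo \<open>s\<close>, so not divisible by 3, unlike
      \<open>2 ^ h * q\<close>.\<close>
    assume nd: "\<not> 3 dvd d"
    then have "3 dvd s" using sd3 unfolding sq3 by (auto split: if_splits)
    obtain k l where kl: "Complex (of_int d) (of_int (- s)) ^ Suc n =
      Complex (of_int (d ^ Suc n + (- s) * k)) (of_int ((- s) * (int (Suc n) * d ^ n + (- s) * l)))"
      using complex_power_expand by blast
    have "Complex (of_int s) (of_int d) = \<i> * Complex (of_int d) (of_int (- s))"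
      by (simp add: complex_eq_iff)
    then have "Complex (of_int s) (of_int d) ^ p = \<i> ^ p * Complex (of_int d) (of_int (- s)) ^ Suc n"
      by (simp only: power_mult_distrib n)
    moreover have "\<i> ^ p = - \<i>"
    proof -
      have "p = 4 * (p div 4) + 3" using p4 by presburger
      then have "\<i> ^ p = (\<i> ^ 4) ^ (p div 4) * \<i> ^ 3" by (metis power_add power_mult)
      then show ?thesis by (simp add: power4_eq_xxxx power3_eq_cube)
    qed
    ultimately have "Im (Complex (of_int s) (of_int d) ^ p) = of_int (- (d ^ p + (- s) * k))"
      unfolding kl n by simp
    then have "2 ^ h * q = - (d ^ p + (- s) * k)" unfolding Im by (simp only: of_int_eq_iff)
    then have "d ^ p = s * k - 2 ^ h * q" by simp
    then have "3 dvd d ^ p" using \<open>3 dvd s\<close> q3 by simp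
    then show False using nd prime3 prime_dvd_power by blast
  qed
  then have s3: "\<not> 3 dvd s" using sd3 unfolding sq3 by (auto split: if_splits)
  obtain k l where kl: "Complex (of_int s) (of_int d) ^ Suc n =
      Complex (of_int (s ^ Suc n + d * k)) (of_int (d * (int (Suc n) * s ^ n + d * l)))"
    using complex_power_expand by blast
  define U where "U = int p * s ^ n + d * l"
  have "of_int (d * U) = real_of_int (2 ^ h * q)" using Im unfolding U_def n kl complex.sel .
  then have dU: "d * U = 2 ^ h * q" by (simp only: of_int_eq_iff)
  have even_n: "even n" using odd_p n by simp
  \<comment> \<open>Modulo 3 the quotient is \<open>p * s ^ (p - 1)\<close>, and the power is 1
    because its exponent is even. So \<open>q\<close> must divide \<open>d\<close>, while oddness of
    \<open>d\<close> gives the converse.\<close>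
  have U3: "U mod 3 = 2"
  proof -
    have "s ^ n mod 3 = 1"
    proof -
      have "s ^ n = (s\<^sup>2) ^ (n div 2)" using even_n by (simp flip: power_mult)
      then have "s ^ n mod 3 = (s\<^sup>2 mod 3) ^ (n div 2) mod 3" by (simp add: power_mod)
      then show ?thesis unfolding sq3 using s3 by simp
    qed
    moreover have "int p mod 3 = 2" using p3 by presburger
    moreover have "U mod 3 = ((int p mod 3) * (s ^ n mod 3)) mod 3"
      using d3 by (auto simp: U_def mod_mult_eq dvd_def mult.assoc)
    ultimately show ?thesis by simp
  qed
  have "coprime q U"
  proof -
    have "\<not> 3 dvd U" using U3 by presburger
    then show ?thesis using prime_imp_coprime[OF prime3] by (simp add: q_def)
  qed
  moreover have "q dvd d * U" unfolding dU by simp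
  ultimately have qd: "q dvd d" by (simp add: coprime_dvd_mult_left_iff)
  have d_odd: "odd d"
  proof -
    have "odd (a + b)" using ab q_odd by simp
    then have "odd (u\<^sup>2 + v\<^sup>2)" unfolding uvY using \<open>odd Y\<close> by simp
    then show ?thesis by (simp add: d_def)
  qed
  then have "coprime d (2 ^ h)" by (simp add: coprime_commute)
  moreover have "d dvd 2 ^ h * q" unfolding dU [symmetric] by simp
  ultimately have "d dvd q" by (simp add: coprime_dvd_mult_right_iff)
  then have "\<bar>d\<bar> = \<bar>q\<bar>" using qd zdvd_antisym_abs by blast
  then have dq: "d = q \<or> d = - q" by (auto simp: q_def abs_if split: if_splits)
  \<comment> \<open>Since \<open>h\<close> is odd, \<open>- (2 ^ h)\<close> is 1 modulo 3, whereas
    \<open>U\<close> is 2; this excludes \<open>d = - q\<close>.\<close>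
  have h2: "2 ^ h mod 3 = (2::int)"
  proof -
    have "odd h" using p4 unfolding h_def by presburger
    then obtain j where "h = 2 * j + 1" using oddE by blast
    then have "(2::int) ^ h = 4 ^ j * 2" by (simp add: power_mult)
    moreover have "(4::int) ^ j mod 3 = 1" using power_mod[of "4::int" 3 j] by simp
    ultimately show ?thesis by presburger
  qed
  have q0: "q \<noteq> 0" by (simp add: q_def)
  show ?thesis
  proof (cases "d = q")
    case True
    have "Im (Complex (of_int s) (of_int (3 ^ m)) ^ p) = of_int (3 ^ m * 2 ^ h)"
      using Im True unfolding q_def by (simp add: mult.commute)
    then show ?thesis unfolding h_def by blast
  next
    case False
    then have "q * (U + 2 ^ h) = 0" using dU dq by (auto simp: algebra_simps)
    then have "U = - (2 ^ h)" using q0 by simp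
    then have "(2 + 2 ^ h) mod 3 = (0::int)" using U3 by presburger
    then show ?thesis using h2 by presburger
  qed
qed

section \<open>Sieving small exponents \<open>m\<close> modulo small primes\<close>

fun gauss_sq :: "int \<Rightarrow> int \<times> int \<Rightarrow> int \<times> int" where
  "gauss_sq q (a, b) = ((a * a - b * b) mod q, (2 * (a * b)) mod q)"

fun gauss_times :: "int \<Rightarrow> int \<Rightarrow> int \<Rightarrow> int \<times> int \<Rightarrow> int \<times> int" where
  "gauss_times q s d (a, b) = ((a * s - b * d) mod q, (a * d + b * s) mod q)"

text \<open>Square-and-multiply for \<open>(s + \<i> d) ^ n\<close>, reduced modulo \<open>q\<close>
  at each step so that evaluation stays cheap.\<close>

fun gauss_pow_mod :: "int \<Rightarrow> int \<Rightarrow> int \<Rightarrow> nat \<Rightarrow> int \<times> int" where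
  "gauss_pow_mod q s d n =
    (if n = 0 then (1, 0)
     else if even n then gauss_sq q (gauss_pow_mod q s d (n div 2))
     else gauss_times q s d (gauss_sq q (gauss_pow_mod q s d (n div 2))))"

declare gauss_pow_mod.simps [simp del]

lemma gauss_pow_mod:
  assumes "q > 1"
  shows "\<exists>a b. Complex (of_int s) (of_int d) ^ n = Complex (of_int a) (of_int b) \<and>
    gauss_pow_mod q (s mod q) (d mod q) n = (a mod q, b mod q)"
proof (induction n rule: less_induct)
  case (less n)
  let ?\<alpha> = "Complex (of_int s) (of_int d)"
  show ?case
  proof (cases "n = 0")
    case True
    then show ?thesis using assms
      by (intro exI[of _ 1] exI[of _ 0]) (simp add: complex_eq_iff gauss_pow_mod.simps)
  next
    case False
    then obtain a b where ab: "?\<alpha> ^ (n div 2) = Complex (of_int a) (of_int b)"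
      "gauss_pow_mod q (s mod q) (d mod q) (n div 2) = (a mod q, b mod q)"
      using less[of "n div 2"] by auto
    define e where "e = a * a - b * b"
    define f where "f = 2 * (a * b)"
    have ef: "(?\<alpha> ^ (n div 2))\<^sup>2 = Complex (of_int e) (of_int f)"
      unfolding ab by (simp add: complex_eq_iff power2_eq_square e_def f_def)
    have sq: "gauss_sq q (a mod q, b mod q) = (e mod q, f mod q)"
      by (simp add: e_def f_def mod_diff_cong[OF mod_mult_eq mod_mult_eq] mod_mult_cong[OF refl mod_mult_eq])
    show ?thesis
    proof (cases "even n")
      case True
      then have "?\<alpha> ^ n = Complex (of_int e) (of_int f)" unfolding ef [symmetric] by (simp flip: power_mult)
      moreover have "gauss_pow_mod q (s mod q) (d mod q) n = (e mod q, f mod q)"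
        using True False ab(2) sq by (subst gauss_pow_mod.simps) simp
      ultimately show ?thesis by blast
    next
      case nodd: False
      then have "n = n div 2 * 2 + 1" by presburger
      then have "?\<alpha> ^ n = (?\<alpha> ^ (n div 2))\<^sup>2 * ?\<alpha>" by (metis power_add power_mult power_one_right)
      also have "\<dots> = Complex (of_int (e * s - f * d)) (of_int (e * d + f * s))"
        unfolding ef by (simp add: complex_eq_iff)
      finally have "?\<alpha> ^ n = \<dots>" .
      moreover have "gauss_times q (s mod q) (d mod q) (e mod q, f mod q) =
          ((e * s - f * d) mod q, (e * d + f * s) mod q)"
        by (simp add: mod_diff_cong[OF mod_mult_eq mod_mult_eq] mod_add_cong[OF mod_mult_eq mod_mult_eq])
      then have "gauss_pow_mod q (s mod q) (d mod q) n = ((e * s - f * d) mod q, (e * d + f * s) mod q)"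
        using nodd False ab(2) sq by (subst gauss_pow_mod.simps) simp
      ultimately show ?thesis by blast
    qed
  qed
qed

text \<open>For \<open>q \<in> {5, 11, 13, 41}\<close> every element of \<open>\<int>[\<i>]/q\<close> satisfies \<open>z\<^bsup>121\<^esup> = z\<close>, so only \<open>p mod 120\<close> matters;
  the exponents of 2 are \<open>(p - 1) / 2\<close> for the three residues.\<close>

definition sieve_at :: "int \<Rightarrow> int \<Rightarrow> int \<Rightarrow> bool" where
  "sieve_at q d s \<longleftrightarrow> gauss_pow_mod q s d 121 = (s, d) \<and>
     snd (gauss_pow_mod q s d 59) \<noteq> d * 2 ^ 29 mod q \<and>
     snd (gauss_pow_mod q s d 83) \<noteq> d * 2 ^ 41 mod q \<and>
     snd (gauss_pow_mod q s d 107) \<noteq> d * 2 ^ 53 mod q"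

text \<open>The predicate is kept partially applied so that \<open>code_simp\<close> does not expand it under a binder.\<close>

definition sieve :: "int \<Rightarrow> int \<Rightarrow> bool" where
  "sieve q d \<longleftrightarrow> list_all (sieve_at q d) [0..q - 1]"

text \<open>The second argument is \<open>3 ^ m mod q\<close>. Modulo 5 the odd \<open>m\<close> are
  covered, modulo 11 the case \<open>m = 8\<close>, modulo 13 the cases 4 and 10, and modulo 41 the
  cases 2 and 6.\<close>

lemma sieve_5_2: "sieve 5 2" by code_simp
lemma sieve_5_3: "sieve 5 3" by code_simp
lemma sieve_11_5: "sieve 11 5" by code_simp
lemma sieve_13_3: "sieve 13 3" by code_simp
lemma sieve_41_9: "sieve 41 9" by code_simp
lemma sieve_41_32: "sieve 41 32" by code_simp

lemma sieveD:
  fixes s d q :: int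
  assumes "sieve q (d mod q)" "q > 1" "p mod 120 \<in> {59, 83, 107}" "2 ^ 60 mod q = 1"
    and eq: "Im (Complex (of_int s) (of_int d) ^ p) = of_int (d * 2 ^ ((p - 1) div 2))"
  shows False
proof -
  let ?\<alpha> = "Complex (of_int s) (of_int d)"
  define i where "i = p div 120"
  define r where "r = p mod 120"
  have pr: "p = 120 * i + r" unfolding i_def r_def by presburger
  have r: "r = 59 \<or> r = 83 \<or> r = 107" using assms(3) unfolding r_def by simp
  have "s mod q \<in> set [0..q - 1]" using assms(2) by simp
  then have at: "sieve_at q (d mod q) (s mod q)"
    using assms(1) unfolding sieve_def list_all_iff by blast
  obtain a b where ab: "?\<alpha> ^ 121 = Complex (of_int a) (of_int b)" "a mod q = s mod q" "b mod q = d mod q"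
    using gauss_pow_mod[OF assms(2), of s d 121] at unfolding sieve_at_def by auto
  obtain k l where "a = s + q * k" "b = d + q * l"
    using ab(2,3) by (metis mod_eqE)
  then have step: "?\<alpha> ^ 121 = ?\<alpha> + of_int q * Complex (of_int k) (of_int l)"
    unfolding ab(1) by (simp add: complex_eq_iff)
  have "\<exists>g\<in>gauss_ints. ?\<alpha> ^ (120 * j + r) = ?\<alpha> ^ r + of_int q * g" for j
  proof (induction j)
    case 0
    show ?case by (intro bexI[of _ 0]) auto
  next
    case (Suc j)
    then obtain g where g: "g \<in> gauss_ints" "?\<alpha> ^ (120 * j + r) = ?\<alpha> ^ r + of_int q * g" by blast
    \<comment> \<open>As \<open>r\<close> is positive, one factor \<open>?\<alpha>\<close> can be
      split off and traded for \<open>?\<alpha> ^ 121\<close>; \<open>?\<alpha>\<close> need not be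
      invertible modulo \<open>q\<close>.\<close>
    have "120 * Suc j + r = 121 + (120 * j + (r - 1))" "120 * j + r = 1 + (120 * j + (r - 1))"
      using r by auto
    then have "?\<alpha> ^ (120 * Suc j + r) = ?\<alpha> ^ 121 * ?\<alpha> ^ (120 * j + (r - 1))"
      "?\<alpha> ^ (120 * j + r) = ?\<alpha> * ?\<alpha> ^ (120 * j + (r - 1))"
      by (metis power_add, metis power_add power_one_right)
    then have "?\<alpha> ^ (120 * Suc j + r) = ?\<alpha> ^ r + of_int q *
        (g + Complex (of_int k) (of_int l) * ?\<alpha> ^ (120 * j + (r - 1)))"
      unfolding step using g(2) by (simp add: algebra_simps)
    moreover have "g + Complex (of_int k) (of_int l) * ?\<alpha> ^ (120 * j + (r - 1)) \<in> gauss_ints"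
      using g(1) by (intro gauss_ints_add gauss_ints_mult gauss_ints_power gauss_ints_Complex)
    ultimately show ?case by blast
  qed
  then obtain g where g: "g \<in> gauss_ints" "?\<alpha> ^ p = ?\<alpha> ^ r + of_int q * g" unfolding pr by blast
  obtain g1 g2 where g12: "g = Complex (of_int g1) (of_int g2)" using g(1) by (rule gauss_intsE)
  obtain a' b' where a'b': "?\<alpha> ^ r = Complex (of_int a') (of_int b')"
    "gauss_pow_mod q (s mod q) (d mod q) r = (a' mod q, b' mod q)"
    using gauss_pow_mod[OF assms(2)] by blast
  have "real_of_int (d * 2 ^ ((p - 1) div 2)) = real_of_int (b' + q * g2)"
    unfolding eq [symmetric] g(2) a'b'(1) g12 by simp
  then have b': "d * 2 ^ ((p - 1) div 2) = b' + q * g2" by (simp only: of_int_eq_iff)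
  have "(p - 1) div 2 = 60 * i + (r - 1) div 2" using r by (auto simp: pr)
  then have pow: "(2::int) ^ ((p - 1) div 2) = (2 ^ 60) ^ i * 2 ^ ((r - 1) div 2)"
    by (simp only: power_add power_mult)
  have "[(2 ^ 60) ^ i = 1 ^ i] (mod q)" using assms(2,4) by (intro cong_pow) (simp add: cong_def)
  then have "[d * ((2 ^ 60) ^ i * 2 ^ ((r - 1) div 2)) = (d mod q) * (1 ^ i * 2 ^ ((r - 1) div 2))] (mod q)"
    by (intro cong_mult cong_refl) (simp_all add: cong_def)
  then have "b' mod q = (d mod q) * 2 ^ ((r - 1) div 2) mod q"
    unfolding pow [symmetric] b' by (simp add: cong_def)
  then show False using at a'b'(2) r unfolding sieve_at_def by auto
qed

lemma exponent_ge_12: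
  assumes "p mod 120 \<in> {59, 83, 107}" "m \<ge> 1"
    and eq: "Im (Complex (of_int s) (of_int (3 ^ m)) ^ p) = of_int (3 ^ m * 2 ^ ((p - 1) div 2))"
  shows "m \<ge> 12"
proof (rule ccontr)
  assume "\<not> m \<ge> 12"
  then have "m = 1 \<or> m = 2 \<or> m = 3 \<or> m = 4 \<or> m = 5 \<or> m = 6 \<or> m = 7 \<or> m = 8 \<or>
      m = 9 \<or> m = 10 \<or> m = 11"
    using assms(2) by presburger
  moreover have no: "\<not> sieve q (3 ^ m mod q)" if "q > 1" "2 ^ 60 mod q = 1" for q
    using sieveD[OF _ that(1) assms(1) that(2) eq] by blast
  have "\<not> sieve 5 (3 ^ m mod 5)" "\<not> sieve 11 (3 ^ m mod 11)" "\<not> sieve 13 (3 ^ m mod 13)"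
    "\<not> sieve 41 (3 ^ m mod 41)"
    by (rule no; simp)+
  ultimately show False
    using sieve_5_2 sieve_5_3 sieve_11_5 sieve_13_3 sieve_41_9 sieve_41_32
    by (elim disjE) simp_all
qed

section \<open>Removal of powers of 2, growth estimates and the final contradiction\<close>

lemma norm_form_descent:
  fixes X Y :: int
  assumes "p mod 8 = (3::int)" "p * Y\<^sup>2 - X\<^sup>2 = 2 ^ (2 * k + 1)"
  shows "\<exists>a b. X = 2 ^ k * a \<and> p * b\<^sup>2 - a\<^sup>2 = 2"
  using assms(2)
proof (induction k arbitrary: X Y)
  case 0
  then show ?case by (intro exI[of _ X] exI[of _ Y]) simp
next
  case (Suc k)
  have odd_p: "odd p" using assms(1) by presburger
  have e8: "p * Y\<^sup>2 - X\<^sup>2 = 8 * 2 ^ (2 * k)" using Suc.prems by simp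
  have par: "even X \<longleftrightarrow> even Y"
  proof -
    have "even (p * Y\<^sup>2 - X\<^sup>2)" unfolding e8 by simp
    then show ?thesis using odd_p by simp
  qed
  \<comment> \<open>For odd \<open>X\<close> and \<open>Y\<close> the form would be
    \<open>3 - 1 = 2\<close> modulo 8, but it is divisible by 8. So both are even and a factor 4
    cancels, keeping the exponent of 2 odd until it is 1.\<close>
  have "even X"
  proof (rule ccontr)
    assume "odd X"
    have "z\<^sup>2 mod 8 = 1" if "odd z" for z :: int
    proof -
      obtain j where j: "z = 2 * j + 1" using \<open>odd z\<close> by (rule oddE)
      have "even (j * (j + 1))" by simp
      then obtain i where "j * (j + 1) = 2 * i" by (elim evenE)
      then have "z\<^sup>2 = 8 * i + 1" unfolding j by (simp add: power2_eq_square algebra_simps)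
      then show ?thesis by simp
    qed
    then have sq: "X\<^sup>2 mod 8 = 1" "Y\<^sup>2 mod 8 = 1" using \<open>odd X\<close> par by blast+
    have "(p * Y\<^sup>2 - X\<^sup>2) mod 8 = ((p mod 8) * (Y\<^sup>2 mod 8) - X\<^sup>2 mod 8) mod 8"
      by (rule mod_diff_cong) (simp_all add: mod_mult_eq)
    also have "\<dots> = 2" unfolding sq assms(1) by simp
    finally show False unfolding e8 by simp
  qed
  then obtain X' Y' where XY: "X = 2 * X'" "Y = 2 * Y'" using par by (auto elim!: evenE)
  have "p * Y'\<^sup>2 - X'\<^sup>2 = 2 ^ (2 * k + 1)" using e8 by (simp add: XY power_mult_distrib)
  then obtain a b where "X' = 2 ^ k * a" "p * b\<^sup>2 - a\<^sup>2 = 2" using Suc.IH by blast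
  then show ?case by (intro exI[of _ a] exI[of _ b]) (simp add: XY)
qed

text \<open>Here 1892 is \<open>4 * 473\<close>, with 473 the value of \<open>(p - 1) div 2\<close>
  at the largest exponent 947. The inequality still fails at \<open>m = 11\<close>, which is why the
  sieve runs up to there.\<close>

lemma growth: "m \<ge> 12 \<Longrightarrow> 4 + 1892 * (m + 8) < 11 * 3 ^ (m - 4)" for m :: nat
proof (induction m rule: nat_induct_at_least)
  case (Suc n)
  then have "Suc n - 4 = Suc (n - 4)" by simp
  then have "11 * 3 ^ (Suc n - 4) = 3 * (11 * 3 ^ (n - 4) :: nat)" by simp
  then show ?case using Suc by simp
qed simp

text \<open>The Pell solution built from \<open>x\<close>, \<open>y\<close> has logarithm at least
  of order \<open>3 ^ m\<close> but at most linear in \<open>m\<close>. As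
  \<open>243 = 3 ^ 5\<close> does not divide \<open>w\<close>, \<open>pell_large\<close> applies
  with \<open>c0 = 4\<close>, whence the exponents \<open>m - 4\<close>.\<close>

lemma no_solution:
  fixes p m x y :: nat and t w :: int
  assumes "prime p" "p mod 120 \<in> {59, 83, 107}" "p \<le> 947"
    and cert: "t\<^sup>2 - int p * w\<^sup>2 = 1" "t > 0" "w > 0" "3 dvd w" "\<not> 243 dvd w"
    and m: "m \<ge> 1" and cop: "coprime x y"
  shows "x ^ 2 + 3 ^ (2 * m) \<noteq> 2 * y ^ p"
proof
  assume eq: "x ^ 2 + 3 ^ (2 * m) = 2 * y ^ p"
  have p24: "p mod 24 = 11" using assms(2) mod_mod_cancel[of 24 120 p] by auto
  have p8: "p mod 8 = 3" and p4: "p mod 4 = 3"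
    using p24 mod_mod_cancel[of 8 24 p] mod_mod_cancel[of 4 24 p] by simp_all
  have p59: "p \<ge> 59"
  proof -
    have "59 \<le> p mod 120" using assms(2) by auto
    also have "\<dots> \<le> p" by simp
    finally show ?thesis .
  qed
  interpret gauss_period p using assms(1) p4 p59 by unfold_locales auto
  define h where "h = (p - 1) div 2"
  define d :: int where "d = 3 ^ m"
  obtain s where s: "Im (Complex (of_int s) (of_int (3 ^ m)) ^ p) = of_int (3 ^ m * 2 ^ h)"
    using descent[OF p24 m cop eq] unfolding h_def by blast
  have m12: "m \<ge> 12" using exponent_ge_12[OF assms(2) m] s unfolding h_def by blast
  have d0: "d \<noteq> 0" "d > 0" by (simp_all add: d_def)
  have sd: "Im (Complex (of_int s) (of_int d) ^ p) = of_int (d * 2 ^ h)" using s by (simp add: d_def)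
  have hp: "p - 1 = 2 * h" using p4 unfolding h_def by presburger
  \<comment> \<open>Otherwise \<open>large_quotient\<close> would give
    \<open>2 ^ h \<ge> 2 ^ (2 * h)\<close>.\<close>
  have "\<bar>s\<bar> < 2 * int p * \<bar>d\<bar>"
  proof (rule ccontr)
    assume "\<not> ?thesis"
    then have "\<bar>2 ^ h :: int\<bar> \<ge> 2 ^ (p - 1)" using large_quotient[OF d0(1) sd] by simp
    then have "p - 1 \<le> h" by simp
    then show False using hp p59 by simp
  qed
  then have "real_of_int \<bar>s\<bar> \<le> real_of_int (2 * int p * \<bar>d\<bar>)" by (simp only: of_int_le_iff less_imp_le)
  then have "norm (Complex (of_int s) (of_int d)) \<le> (2 * real p + 1) * 3 ^ m"
    using cmod_le[of "Complex (of_int s) (of_int d)"] by (simp add: d_def algebra_simps)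
  then have "2 * norm (Complex (of_int s) (of_int d)) \<le> (2 * (2 * real p + 1)) * 3 ^ m"
    by (simp only: mult.assoc mult_le_cancel_left_pos zero_less_numeral)
  \<comment> \<open>For \<open>p \<le> 947\<close> the constant is at most 3790, and
    \<open>3 ^ 8 = 6561\<close>.\<close>
  also have "\<dots> \<le> 3 ^ 8 * 3 ^ m" using assms(3) by (intro mult_right_mono) simp_all
  finally have n: "2 * norm (Complex (of_int s) (of_int d)) \<le> 3 ^ (m + 8)"
    by (simp add: power_add)
  obtain X Y where XY: "int p * Y\<^sup>2 - X\<^sup>2 = 4 * 2 ^ h" "d dvd X"
      "of_int \<bar>X\<bar> \<le> 2 * (2 * norm (Complex (of_int s) (of_int d))) ^ h"
    using gauss_norm_form[OF d0(1) sd] unfolding h_def by blast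
  have "(2 * norm (Complex (of_int s) (of_int d))) ^ h \<le> (3 ^ (m + 8)) ^ h"
    using n by (intro power_mono) auto
  then have "of_int \<bar>X\<bar> \<le> (2 * (3 ^ (m + 8)) ^ h :: real)" using XY(3) by linarith
  then have "real_of_int \<bar>X\<bar> \<le> real_of_int (2 * (3 ^ (m + 8)) ^ h)" by simp
  then have X: "\<bar>X\<bar> \<le> 2 * 3 ^ ((m + 8) * h)" unfolding of_int_le_iff power_mult .
  define k where "k = (h + 1) div 2"
  have hk: "h + 2 = 2 * k + 1" using p8 unfolding k_def h_def by presburger
  then have "int p * Y\<^sup>2 - X\<^sup>2 = 2 ^ (2 * k + 1)"
    using XY(1) unfolding hk [symmetric] power_add by simp
  moreover have "int p mod 8 = 3" using p8 by presburger
  ultimately obtain a b where ab: "X = 2 ^ k * a" "int p * b\<^sup>2 - a\<^sup>2 = 2"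
    using norm_form_descent by blast
  have "coprime d (2 ^ k)" by (simp add: d_def)
  then have da: "d dvd a" using XY(2) unfolding ab(1) by (simp add: coprime_dvd_mult_right_iff)
  have b0: "b \<noteq> 0" using ab(2) by (auto simp: power2_eq_square) (smt (verit) mult_minus_left zero_le_square)
  have a0: "a \<noteq> 0"
  proof
    assume "a = 0"
    then have "int p * b\<^sup>2 = 2" using ab(2) by simp
    then have "int p dvd 2" by (metis dvd_triv_left)
    then show False using p59 zdvd_imp_le[of "int p" 2] by simp
  qed
  \<comment> \<open>From \<open>p * b^2 = a^2 + 2\<close>, the square of
    \<open>a + b sqrt p\<close>, divided by 2, is \<open>(a^2 + 1) + a b sqrt p\<close>, an element
    of norm 1.\<close>
  define T where "T = a\<^sup>2 + 1"
  define W where "W = \<bar>a * b\<bar>"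
  have "T\<^sup>2 - int p * W\<^sup>2 = (a\<^sup>2 + 1)\<^sup>2 - a\<^sup>2 * (int p * b\<^sup>2)"
    by (simp add: T_def W_def power_mult_distrib)
  also have "int p * b\<^sup>2 = a\<^sup>2 + 2" using ab(2) by simp
  also have "(a\<^sup>2 + 1)\<^sup>2 - a\<^sup>2 * (a\<^sup>2 + 2) = 1" by (simp add: power2_eq_square algebra_simps)
  finally have "T\<^sup>2 - int p * W\<^sup>2 = 1" .
  moreover have "T > 0" by (simp add: T_def add_nonneg_pos)
  moreover have "W > 0" using a0 b0 by (simp add: W_def)
  moreover have "3 ^ m dvd W" using da by (simp add: W_def d_def)
  ultimately have low: "(9 ^ 4 * int p) ^ (3 ^ (m - 4)) \<le> T\<^sup>2"
    using pell_large[of "int p" t w 4 T W m] cert m12 p59 by simp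
  have "1 * \<bar>a\<bar> \<le> \<bar>X\<bar>" unfolding ab(1) abs_mult by (intro mult_right_mono) auto
  then have "\<bar>a\<bar> \<le> 2 * 3 ^ ((m + 8) * h)" using X by simp
  then have "a\<^sup>2 \<le> (2 * 3 ^ ((m + 8) * h))\<^sup>2" by (metis abs_ge_zero power2_abs power_mono)
  also have "\<dots> = 4 * 3 ^ ((m + 8) * h * 2)" by (simp add: power_mult_distrib flip: power_mult)
  finally have "T \<le> 4 * 3 ^ ((m + 8) * h * 2) + 1" by (simp add: T_def)
  moreover have "(1::int) \<le> 3 ^ ((m + 8) * h * 2)" by simp
  ultimately have "T \<le> 9 * 3 ^ ((m + 8) * h * 2)" by linarith
  then have "T\<^sup>2 \<le> (3 ^ (2 + (m + 8) * h * 2))\<^sup>2"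
    using \<open>T > 0\<close> by (intro power_mono) (simp_all add: power_add)
  also have "\<dots> = 3 ^ (4 + 4 * h * (m + 8))" 
    unfolding power_mult [symmetric] by (rule arg_cong[of _ _ "power 3"]) (simp add: algebra_simps)
  also have "\<dots> \<le> 3 ^ (4 + 1892 * (m + 8))"
    using assms(3) hp by (intro power_increasing add_left_mono mult_right_mono) auto
  also have "\<dots> < 3 ^ (11 * 3 ^ (m - 4))" using growth[OF m12] by (intro power_strict_increasing) auto
  also have "\<dots> = (3 ^ 11) ^ (3 ^ (m - 4))" by (simp only: power_mult)
  \<comment> \<open>\<open>9 ^ 4 * p\<close> is at least \<open>3 ^ 8 * 3 ^ 3\<close>, as
    \<open>p \<ge> 27\<close>.\<close>
  also have "\<dots> \<le> (9 ^ 4 * int p) ^ (3 ^ (m - 4))" using p59 by (intro power_mono) auto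
  finally show False using low by simp
qed

text \<open>In a factorisation of \<open>p < (n + 1)^2\<close> one factor is at most
  \<open>n\<close>, hence divides \<open>fact n\<close>, and coprimality makes it 1.\<close>

lemma prime_if_coprime_fact:
  fixes p :: nat
  assumes p: "1 < p" "p < (n + 1)\<^sup>2" and cop: "coprime p (fact n)"
  shows "prime p"
  unfolding prime_nat_iff
proof (intro conjI allI impI p(1))
  have small: "c = 1" if "c dvd p" "c \<le> n" for c
  proof -
    have "c > 0" using that(1) p(1) by (intro Nat.gr0I) auto
    then have "c dvd fact n" using that(2) by (intro dvd_fact) auto
    then show ?thesis using cop that(1) coprime_common_divisor_nat by blast
  qed
  fix a assume a: "a dvd p"
  then obtain b where b: "p = a * b" by (rule dvdE)
  have "a \<le> n \<or> b \<le> n"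
  proof (rule ccontr)
    assume "\<not> (a \<le> n \<or> b \<le> n)"
    then have "(n + 1) * (n + 1) \<le> a * b" by (intro mult_le_mono) auto
    then show False using p(2) b by (simp add: power2_eq_square)
  qed
  then have "a = 1 \<or> b = 1" using small a b by auto
  then show "a = 1 \<or> a = p" using b by auto
qed
theorem theorem5:
  fixes p m x y :: nat
  assumes "p \<in> {59,83,107,179,227,347,419,443,467,563,587,659,683,827,947}"
    and "m \<ge> 1" and "x > 0" and "y > 0" and "coprime x y"
  shows "x ^ 2 + 3 ^ (2 * m) \<noteq> 2 * y ^ p"
proof -
  have "\<exists>t w. t\<^sup>2 - int p * w\<^sup>2 = 1 \<and> t > 0 \<and> w > 0 \<and> 3 dvd w \<and> \<not> 243 dvd w"
  proof -
    \<comment> \<open>The powers of the fundamental solutions with the least exponent such that 3 divides \<open>w\<close>.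
      For \<open>p = 683\<close> this \<open>w\<close> is divisible by 81, which forces the bound 243.\<close>
    let ?c = "\<lambda>p t w. t\<^sup>2 - int p * w\<^sup>2 = 1 \<and> t > 0 \<and> w > 0 \<and> 3 dvd w \<and> \<not> 243 dvd w"
    have c: "?c 59 530 69"
      "?c 83 82 9"
      "?c 107 962 93"
      "?c 179 4190210 313191"
      "?c 227 226 15"
      "?c 347 641602 34443"
      "?c 419 270174970 13198911"
      "?c 443 442 21"
      "?c 467 1625626 75225"
      "?c 563 68122 2871"
      "?c 587 1907162 78717"
      "?c 659 5930 231"
      "?c 683 170067682 6507459"
      "?c 827 900602 31317"
      "?c 947 13509645362 439004487"
      by simp_all
    show ?thesis using assms(1) by (elim insertE emptyE) (simp_all only:, (rule c exI)+)
  qed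
  then obtain t w where tw: "t\<^sup>2 - int p * w\<^sup>2 = 1" "t > 0" "w > 0" "3 dvd w" "\<not> 243 dvd w" by blast
  \<comment> \<open>The choice 30 suffices because \<open>31 ^ 2 = 961\<close> exceeds 947.\<close>
  have "coprime p (fact 30)"
    using assms(1) by (elim insertE emptyE) (simp_all add: fact_numeral coprime_iff_gcd_eq_1 gcd_non_0_nat)
  moreover have "1 < p" "p < (30 + 1)\<^sup>2" using assms(1) by auto
  ultimately have "prime p" by (intro prime_if_coprime_fact)
  moreover have "p mod 120 \<in> {59, 83, 107}" using assms(1) by (elim insertE emptyE) simp_all
  moreover have "p \<le> 947" using assms(1) by (elim insertE emptyE) simp_all
  ultimately show ?thesis by (rule no_solution[OF _ _ _ tw assms(2,5)])
qed

end
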